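(* Let $A\xrightarrow{f}B\xrightarrow{g}C$ be a short exact sequence of $\mathcal{A}(1)$-modules which is split as an exact sequence of $\Lambda(Q_0)$-modules. Then $RA\to RB\to RC$ is a short $(\mathcal{E},\Lambda_0)$-exact sequence.
   Context: $\mathbb{F}$ is the field with two elements. $\mathcal{A}(1)$ is the subalgebra of the mod $2$ Steenrod algebra generated by $Sq^1,Sq^2$; $Q_0=Sq^1$, $Q_1=Sq^1Sq^2+Sq^2Sq^1$, and $\Lambda(Q_0)\subset\mathcal{A}(1)$ is the exterior algebra on $Q_0$. $\mathcal{E}=\Lambda_{\mathbb{F}}(\mathbb{Q}_0,\mathbb{Q}_1)$ is the exterior algebra on generators of $RO(Q)$-degrees $1$ and $2+\alpha$ ($Q$ the group with two elements, $RO(Q)=\mathbb{Z}\oplus\mathbb{Z}\alpha$), and $\Lambda_0=\Lambda_{\mathbb{F}}(\mathbb{Q}_0)$. A sequence of $\mathcal{E}$-modules is $(\mathcal{E},\Lambda_0)$-exact if it is exact and the underlying sequence of $\Lambda_0$-modules is split. $H=H\underline{\mathbb{F}}^\star_Q$, the coefficient ring of $Q$-equivariant cohomology with constant coefficients $\mathbb{F}$, has $\mathbb{F}$-basis $a^m\sigma^{-n}$ and $a^{-m}\sigma^{n+2}$ ($m,n\ge0$), $|a|=\alpha$, $|\sigma|=1-\alpha$; the first family spans $\mathbb{F}[a,\sigma^{-1}]$, which acts on the second by adding exponents (result $0$ if not of the listed form), and products of two elements of the second family vanish. $\mathcal{E}$ acts on $H$ (all exponents $k\ge0$; terms not of the listed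 form are $0$): $\mathbb{Q}_0(a^k\sigma^{-n})=a^{k+1}\sigma^{-n+1}$ for $n\geq 0$ odd, $0$ for $n$ even; $\mathbb{Q}_0(a^{-k}\sigma^n)=a^{-k+1}\sigma^{n+1}$ for $n\ge2$ even, $0$ for $n$ odd; $\mathbb{Q}_1(a^k\sigma^{-n})=a^{k+3}\sigma^{-n+2}$ if $n\equiv2,3$ mod $4$, else $0$; $\mathbb{Q}_1(a^{-k}\sigma^n)=a^{-k+3}\sigma^{n+2}$ if $n\equiv2,3$ mod $4$, else $0$. The functor $R:\mathcal{A}(1)\text{-mod}\to\mathcal{E}\text{-mod}$ is $R(M)=H\otimes_{\mathbb{F}}M$ with $\mathbb{Q}_0(h\otimes x)=\mathbb{Q}_0(h)\otimes x+h\otimes Q_0x$ and $\mathbb{Q}_1(h\otimes x)=\mathbb{Q}_1(h)\otimes x+a\mathbb{Q}_0(h)\otimes Q_0x+ah\otimes Sq^2x+\sigma^{-1}h\otimes Q_1x$. *)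

theory Defs
  imports "HOL-Library.Poly_Mapping" "HOL-Library.Z2" "HOL-Library.Product_Plus"
begin

section \<open>Algebras over the field with two elements, by generators and relations\<close>

text \<open>
  The ground field is \<^typ>\<open>bit\<close>.  A vector space over it is the same thing as an abelian group
  in which \<open>x + x = 0\<close>, linear means additive, and a subalgebra is a unital subring.

  Words are an additive monoid under concatenation, because \<^typ>\<open>'a \<Rightarrow>\<^sub>0 bit\<close> carries the
  convolution product as soon as \<^typ>\<open>'a\<close> is a \<^class>\<open>monoid_add\<close>.  With this instance,
  \<open>'g word \<Rightarrow>\<^sub>0 bit\<close> is the free associative unital algebra on the set \<open>'g\<close>.
\<close>

datatype 'g word = Word (letters: "'g list")

instantiation word :: (type) monoid_add
begin
definition "0 = Word []"
definition "v + w = Word (letters v @ letters w)"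
instance by standard (simp_all add: zero_word_def plus_word_def)
end

type_synonym 'g freealg = "'g word \<Rightarrow>\<^sub>0 bit"

definition letter :: "'g \<Rightarrow> 'g freealg" where
  "letter g = Poly_Mapping.single (Word [g]) 1"

inductive_set two_sided_ideal :: "'r::ring_1 set \<Rightarrow> 'r set" for S where
  zero: "0 \<in> two_sided_ideal S"
| gen: "s \<in> S \<Longrightarrow> a * s * b \<in> two_sided_ideal S"
| add: "x \<in> two_sided_ideal S \<Longrightarrow> y \<in> two_sided_ideal S \<Longrightarrow> x + y \<in> two_sided_ideal S"

lemma two_sided_ideal_mult:
  assumes "x \<in> two_sided_ideal S"
  shows "c * x * d \<in> two_sided_ideal S"
  using assms
proof induction
  case zero
  then show ?case by (simp add: two_sided_ideal.zero)
next
  case (gen s a b)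
  have "c * (a * s * b) * d = (c * a) * s * (b * d)" by (simp add: mult.assoc)
  then show ?case using two_sided_ideal.gen[OF gen] by metis
next
  case (add x y)
  then show ?case by (simp add: distrib_left distrib_right two_sided_ideal.add)
qed

lemma two_sided_ideal_uminus: "x \<in> two_sided_ideal S \<Longrightarrow> - x \<in> two_sided_ideal S"
  using two_sided_ideal_mult[of x S "-1" 1] by simp

lemma two_sided_ideal_diff:
  "x \<in> two_sided_ideal S \<Longrightarrow> y \<in> two_sided_ideal S \<Longrightarrow> x - y \<in> two_sided_ideal S"
  using two_sided_ideal.add[of x S "- y"] two_sided_ideal_uminus[of y S] by simp

definition ideal_cong :: "'r::ring_1 set \<Rightarrow> 'r \<Rightarrow> 'r \<Rightarrow> bool" where
  "ideal_cong S x y \<longleftrightarrow> x - y \<in> two_sided_ideal S"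

lemma equivp_ideal_cong: "equivp (ideal_cong S)"
proof (rule equivpI)
  show "reflp (ideal_cong S)"
    by (simp add: reflp_def ideal_cong_def two_sided_ideal.zero)
  show "symp (ideal_cong S)"
    unfolding symp_def ideal_cong_def by (metis minus_diff_eq two_sided_ideal_uminus)
  show "transp (ideal_cong S)"
    unfolding transp_def ideal_cong_def
    by (metis diff_add_cancel add_diff_eq two_sided_ideal.add)
qed

lemma ideal_cong_add:
  assumes "ideal_cong S x x'" "ideal_cong S y y'"
  shows "ideal_cong S (x + y) (x' + y')"
  using two_sided_ideal.add[OF assms[unfolded ideal_cong_def]]
  by (simp add: ideal_cong_def algebra_simps)

lemma ideal_cong_diff:
  assumes "ideal_cong S x x'" "ideal_cong S y y'"
  shows "ideal_cong S (x - y) (x' - y')"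
  using two_sided_ideal_diff[OF assms[unfolded ideal_cong_def]]
  by (simp add: ideal_cong_def algebra_simps)

lemma ideal_cong_uminus:
  assumes "ideal_cong S x x'"
  shows "ideal_cong S (- x) (- x')"
  using two_sided_ideal_uminus[OF assms[unfolded ideal_cong_def]]
  by (simp add: ideal_cong_def algebra_simps)

lemma ideal_cong_mult:
  assumes "ideal_cong S x x'" "ideal_cong S y y'"
  shows "ideal_cong S (x * y) (x' * y')"
proof -
  have "1 * (x - x') * y + x' * (y - y') * 1 \<in> two_sided_ideal S"
    using assms unfolding ideal_cong_def
    by (intro two_sided_ideal.add two_sided_ideal_mult)
  then show ?thesis by (simp add: ideal_cong_def algebra_simps)
qed

text \<open>
  The algebras below are not shown to be nonzero, so they are instances of
  \<open>{ring, monoid_mult}\<close> rather than of \<^class>\<open>ring_1\<close>.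
\<close>

inductive_set generated_subalgebra :: "'r::{ring, monoid_mult} set \<Rightarrow> 'r set" for X where
  one: "1 \<in> generated_subalgebra X"
| gen: "x \<in> X \<Longrightarrow> x \<in> generated_subalgebra X"
| diff: "x \<in> generated_subalgebra X \<Longrightarrow> y \<in> generated_subalgebra X
    \<Longrightarrow> x - y \<in> generated_subalgebra X"
| mult: "x \<in> generated_subalgebra X \<Longrightarrow> y \<in> generated_subalgebra X
    \<Longrightarrow> x * y \<in> generated_subalgebra X"

definition word_degree :: "('g \<Rightarrow> 'd::monoid_add) \<Rightarrow> 'g word \<Rightarrow> 'd" where
  "word_degree dg w = sum_list (map dg (letters w))"

definition free_homogeneous :: "('g \<Rightarrow> 'd::monoid_add) \<Rightarrow> 'd \<Rightarrow> 'g freealg set" where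
  "free_homogeneous dg d = {p. \<forall>w\<in>Poly_Mapping.keys p. word_degree dg w = d}"


section \<open>The mod 2 Steenrod algebra and \<open>A(1)\<close>\<close>

definition adem_relations :: "nat freealg set" where
  "adem_relations = insert (letter 0 - 1)
     {letter i * letter j
        - (\<Sum>k = 0..i div 2. of_nat ((j - k - 1) choose (i - 2 * k)) * (letter (i + j - k) * letter k))
      | i j. 0 < i \<and> i < 2 * j}"

quotient_type steenrod = "nat freealg" / "ideal_cong adem_relations"
  by (rule equivp_ideal_cong)

instantiation steenrod :: "{ring, monoid_mult}"
begin
lift_definition zero_steenrod :: steenrod is 0 .
lift_definition one_steenrod :: steenrod is 1 .
lift_definition plus_steenrod :: "steenrod \<Rightarrow> steenrod \<Rightarrow> steenrod" is "(+)"
  by (rule ideal_cong_add)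
lift_definition minus_steenrod :: "steenrod \<Rightarrow> steenrod \<Rightarrow> steenrod" is "(-)"
  by (rule ideal_cong_diff)
lift_definition uminus_steenrod :: "steenrod \<Rightarrow> steenrod" is "uminus"
  by (rule ideal_cong_uminus)
lift_definition times_steenrod :: "steenrod \<Rightarrow> steenrod \<Rightarrow> steenrod" is "(*)"
  by (rule ideal_cong_mult)
instance
  by standard
    (transfer; simp add: algebra_simps equivp_reflp[OF equivp_ideal_cong])+
end

lift_definition Sq :: "nat \<Rightarrow> steenrod" is letter .

definition steenrod_homogeneous :: "int \<Rightarrow> steenrod set" where
  "steenrod_homogeneous d = abs_steenrod ` free_homogeneous int d"

definition A1 :: "steenrod set" where
  "A1 = generated_subalgebra {Sq 1, Sq 2}"

definition Q0 :: steenrod where "Q0 = Sq 1"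
definition Q1 :: steenrod where "Q1 = Sq 1 * Sq 2 + Sq 2 * Sq 1"

definition LambdaQ0 :: "steenrod set" where
  "LambdaQ0 = generated_subalgebra {Q0}"


section \<open>The exterior algebra \<open>E\<close>\<close>

text \<open>
  The exterior algebra of the vector space \<open>V\<close> with basis \<open>'g\<close> is \<open>T(V)\<close> modulo all
  \<open>v * v\<close> with \<open>v \<in> V\<close>; here \<open>T(V)\<close> is the free algebra on \<open>'g\<close> and \<open>V\<close> its part of length one.
\<close>

definition exterior_relations :: "'g freealg set" where
  "exterior_relations = {v * v | v. \<forall>w\<in>Poly_Mapping.keys v. length (letters w) = 1}"

quotient_type 'g exterior = "'g freealg" / "ideal_cong exterior_relations"
  by (rule equivp_ideal_cong)

instantiation exterior :: (type) "{ring, monoid_mult}"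
begin
lift_definition zero_exterior :: "'a exterior" is 0 .
lift_definition one_exterior :: "'a exterior" is 1 .
lift_definition plus_exterior :: "'a exterior \<Rightarrow> 'a exterior \<Rightarrow> 'a exterior" is "(+)"
  by (rule ideal_cong_add)
lift_definition minus_exterior :: "'a exterior \<Rightarrow> 'a exterior \<Rightarrow> 'a exterior" is "(-)"
  by (rule ideal_cong_diff)
lift_definition uminus_exterior :: "'a exterior \<Rightarrow> 'a exterior" is "uminus"
  by (rule ideal_cong_uminus)
lift_definition times_exterior :: "'a exterior \<Rightarrow> 'a exterior \<Rightarrow> 'a exterior" is "(*)"
  by (rule ideal_cong_mult)
instance
  by standard
    (transfer; simp add: algebra_simps equivp_reflp[OF equivp_ideal_cong])+
end

lift_definition exterior_gen :: "'g \<Rightarrow> 'g exterior" is letter .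

datatype egen = EQ0 | EQ1

type_synonym E = "egen exterior"

text \<open>The pair \<open>(i, j)\<close> stands for the element \<open>i + j \<alpha>\<close> of \<open>RO(Q)\<close>.\<close>

type_synonym roq = "int \<times> int"

fun egen_degree :: "egen \<Rightarrow> roq" where
  "egen_degree EQ0 = (1, 0)"
| "egen_degree EQ1 = (2, 1)"

definition E_homogeneous :: "roq \<Rightarrow> E set" where
  "E_homogeneous d = abs_exterior ` free_homogeneous egen_degree d"

definition Lambda0 :: "E set" where
  "Lambda0 = generated_subalgebra {exterior_gen EQ0}"


section \<open>Graded modules and relatively exact sequences\<close>

definition is_grading :: "('d \<Rightarrow> 'm::ab_group_add set) \<Rightarrow> bool" where
  "is_grading M \<longleftrightarrow>
     (\<forall>d. 0 \<in> M d \<and> (\<forall>x\<in>M d. \<forall>y\<in>M d. x - y \<in> M d)) \<and>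
     (\<forall>x. \<exists>!c. (\<forall>d. c d \<in> M d) \<and> finite {d. c d \<noteq> 0} \<and> x = (\<Sum>d | c d \<noteq> 0. c d))"

text \<open>
  The underlying group of a graded module is the whole type \<open>'m\<close>; it is the internal direct
  sum of the groups \<open>component M d\<close>.  Modules over a subalgebra \<open>S\<close> of the ring \<open>'r\<close> are
  described by an action that is only meaningful on elements of \<open>S\<close>; \<open>hg d\<close> is the set of
  homogeneous elements of degree \<open>d\<close> of \<open>'r\<close>.
\<close>

record ('r, 'd, 'm) gmodule =
  act :: "'r \<Rightarrow> 'm \<Rightarrow> 'm"
  component :: "'d \<Rightarrow> 'm set"

definition graded_module ::
  "'r::{ring, monoid_mult} set \<Rightarrow> ('d::monoid_add \<Rightarrow> 'r set) \<Rightarrow> ('r, 'd, 'm::ab_group_add) gmodule \<Rightarrow> bool"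
where
  "graded_module S hg M \<longleftrightarrow>
     is_grading (component M) \<and>
     (\<forall>r\<in>S. \<forall>x y. act M r (x + y) = act M r x + act M r y) \<and>
     (\<forall>r\<in>S. \<forall>s\<in>S. \<forall>x. act M (r + s) x = act M r x + act M s x) \<and>
     (\<forall>r\<in>S. \<forall>s\<in>S. \<forall>x. act M (r * s) x = act M r (act M s x)) \<and>
     (\<forall>x. act M 1 x = x) \<and>
     (\<forall>k d. \<forall>r\<in>S \<inter> hg k. \<forall>x\<in>component M d. act M r x \<in> component M (k + d))"

definition graded_hom ::
  "'r set \<Rightarrow> ('r, 'd, 'm::ab_group_add) gmodule \<Rightarrow> ('r, 'd, 'n::ab_group_add) gmodule \<Rightarrow> ('m \<Rightarrow> 'n) \<Rightarrow> bool"
where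
  "graded_hom S M N f \<longleftrightarrow>
     (\<forall>x y. f (x + y) = f x + f y) \<and>
     (\<forall>r\<in>S. \<forall>x. f (act M r x) = act N r (f x)) \<and>
     (\<forall>d. f ` component M d \<subseteq> component N d)"

definition short_exact_sequence ::
  "'r::{ring, monoid_mult} set \<Rightarrow> ('d::monoid_add \<Rightarrow> 'r set) \<Rightarrow>
   ('r, 'd, 'a::ab_group_add) gmodule \<Rightarrow> ('r, 'd, 'b::ab_group_add) gmodule \<Rightarrow>
   ('r, 'd, 'c::ab_group_add) gmodule \<Rightarrow> ('a \<Rightarrow> 'b) \<Rightarrow> ('b \<Rightarrow> 'c) \<Rightarrow> bool"
where
  "short_exact_sequence S hg A B C f g \<longleftrightarrow>
     graded_module S hg A \<and> graded_module S hg B \<and> graded_module S hg C \<and>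
     graded_hom S A B f \<and> graded_hom S B C g \<and>
     inj f \<and> range f = {y. g y = 0} \<and> surj g"

definition splits ::
  "'r set \<Rightarrow> ('r, 'd, 'b::ab_group_add) gmodule \<Rightarrow> ('r, 'd, 'c::ab_group_add) gmodule \<Rightarrow>
   ('b \<Rightarrow> 'c) \<Rightarrow> bool"
where
  "splits L B C g \<longleftrightarrow> (\<exists>s. graded_hom L C B s \<and> (\<forall>z. g (s z) = z))"

text \<open>Short \<open>(S, L)\<close>-exact sequences, for a subalgebra \<open>L\<close> of \<open>S\<close>.\<close>

definition short_relative_exact_sequence ::
  "'r::{ring, monoid_mult} set \<Rightarrow> 'r set \<Rightarrow> ('d::monoid_add \<Rightarrow> 'r set) \<Rightarrow>
   ('r, 'd, 'a::ab_group_add) gmodule \<Rightarrow> ('r, 'd, 'b::ab_group_add) gmodule \<Rightarrow>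
   ('r, 'd, 'c::ab_group_add) gmodule \<Rightarrow> ('a \<Rightarrow> 'b) \<Rightarrow> ('b \<Rightarrow> 'c) \<Rightarrow> bool"
where
  "short_relative_exact_sequence S L hg A B C f g \<longleftrightarrow>
     short_exact_sequence S hg A B C f g \<and> splits L B C g"


section \<open>The coefficient ring \<open>H\<close>\<close>

text \<open>\<open>Pos m n\<close> is \<open>a\<^sup>m \<sigma>\<^sup>-\<^sup>n\<close> and \<open>Neg m n\<close> is \<open>a\<^sup>-\<^sup>m \<sigma>\<^sup>n\<^sup>+\<^sup>2\<close>.\<close>

datatype hbasis = Pos nat nat | Neg nat nat

type_synonym H = "hbasis \<Rightarrow>\<^sub>0 bit"

abbreviation hb :: "hbasis \<Rightarrow> H" where
  "hb b \<equiv> Poly_Mapping.single b 1"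

text \<open>The degrees are determined by \<open>|a| = \<alpha>\<close> and \<open>|\<sigma>| = 1 - \<alpha>\<close>.\<close>

fun hdegree :: "hbasis \<Rightarrow> roq" where
  "hdegree (Pos m n) = (- int n, int m + int n)"
| "hdegree (Neg m n) = (int n + 2, - int m - int n - 2)"

definition linear_extension :: "(hbasis \<Rightarrow> 'm::ab_group_add) \<Rightarrow> H \<Rightarrow> 'm" where
  "linear_extension \<phi> h = (\<Sum>b\<in>Poly_Mapping.keys h. \<phi> b)"

text \<open>
  A product of the two families stays in the second one or vanishes; for instance
  \<open>\<sigma>\<^sup>-\<^sup>2\<close> times \<open>\<sigma>\<^sup>2\<close> is \<open>0\<close> and not \<open>1\<close>.
\<close>

fun hbasis_mult :: "hbasis \<Rightarrow> hbasis \<Rightarrow> H" where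
  "hbasis_mult (Pos m n) (Pos m' n') = hb (Pos (m + m') (n + n'))"
| "hbasis_mult (Pos m n) (Neg m' n') = (if m \<le> m' \<and> n \<le> n' then hb (Neg (m' - m) (n' - n)) else 0)"
| "hbasis_mult (Neg m n) (Pos m' n') = (if m' \<le> m \<and> n' \<le> n then hb (Neg (m - m') (n - n')) else 0)"
| "hbasis_mult (Neg m n) (Neg m' n') = 0"

definition hmult :: "H \<Rightarrow> H \<Rightarrow> H" (infixl \<open>\<cdot>\<close> 70) where
  "h \<cdot> h' = linear_extension (\<lambda>b. linear_extension (hbasis_mult b) h') h"

definition H_a :: H where "H_a = hb (Pos 1 0)"
definition H_sigma_inv :: H where "H_sigma_inv = hb (Pos 0 1)"

text \<open>
  \<open>Neg k l\<close> has \<open>\<sigma>\<close>-exponent \<open>l + 2\<close>; it is this exponent, not \<open>l\<close>, that enters the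
  congruence conditions.
\<close>

fun hbasis_Q0 :: "hbasis \<Rightarrow> H" where
  "hbasis_Q0 (Pos k n) = (if odd n then hb (Pos (k + 1) (n - 1)) else 0)"
| "hbasis_Q0 (Neg k l) = (if even (l + 2) \<and> 1 \<le> k then hb (Neg (k - 1) (l + 1)) else 0)"

fun hbasis_Q1 :: "hbasis \<Rightarrow> H" where
  "hbasis_Q1 (Pos k n) = (if n mod 4 \<in> {2, 3} then hb (Pos (k + 3) (n - 2)) else 0)"
| "hbasis_Q1 (Neg k l) = (if (l + 2) mod 4 \<in> {2, 3} \<and> 3 \<le> k then hb (Neg (k - 3) (l + 2)) else 0)"

definition H_Q0 :: "H \<Rightarrow> H" where "H_Q0 = linear_extension hbasis_Q0"
definition H_Q1 :: "H \<Rightarrow> H" where "H_Q1 = linear_extension hbasis_Q1"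


section \<open>Tensoring with \<open>H\<close>\<close>

text \<open>
  As \<open>H\<close> has basis \<^typ>\<open>hbasis\<close>, the tensor product of \<open>H\<close> with \<open>'m\<close> is modelled by the finitely
  supported functions from \<^typ>\<open>hbasis\<close> to \<open>'m\<close>, i.e. the direct sum of copies of \<open>'m\<close>.
  Its universal property is proved below.
\<close>

type_synonym 'm htensor = "hbasis \<Rightarrow>\<^sub>0 'm"

definition tensor :: "H \<Rightarrow> 'm::ab_group_add \<Rightarrow> 'm htensor" (infixl \<open>\<otimes>\<^sub>H\<close> 68) where
  "h \<otimes>\<^sub>H x = linear_extension (\<lambda>b. Poly_Mapping.single b x) h"

definition tensor_lift :: "(H \<Rightarrow> 'm \<Rightarrow> 'n) \<Rightarrow> 'm::ab_group_add htensor \<Rightarrow> 'n::ab_group_add" where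
  "tensor_lift \<beta> z = (\<Sum>b\<in>Poly_Mapping.keys z. \<beta> (hb b) (Poly_Mapping.lookup z b))"

lemma linear_extension_hb [simp]: "linear_extension \<phi> (hb b) = \<phi> b"
  by (simp add: linear_extension_def)

lemma linear_extension_add:
  assumes "\<And>x::'m::ab_group_add. x + x = 0"
  shows "linear_extension \<phi> (h + h') = linear_extension \<phi> h + (linear_extension \<phi> h' :: 'm)"
proof -
  let ?U = "Poly_Mapping.keys h \<union> Poly_Mapping.keys h'"
  let ?v = "\<lambda>k b. if Poly_Mapping.lookup k b = (0::bit) then 0 else \<phi> b"
  have *: "linear_extension \<phi> k = (\<Sum>b\<in>?U. ?v k b)" if "Poly_Mapping.keys k \<subseteq> ?U" for k
    unfolding linear_extension_def
    by (rule sum.mono_neutral_cong_left) (use that in \<open>auto simp: in_keys_iff\<close>)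
  have v: "?v (h + h') b = ?v h b + ?v h' b" for b
    using assms[of "\<phi> b"] by (auto simp: lookup_add)
  have "linear_extension \<phi> (h + h') = (\<Sum>b\<in>?U. ?v h b + ?v h' b)"
    using *[OF keys_add] v by simp
  then show ?thesis
    by (simp add: sum.distrib *)
qed

lemma tensor_add_left:
  assumes "\<And>x::'m::ab_group_add. x + x = 0"
  shows "(h + h') \<otimes>\<^sub>H x = h \<otimes>\<^sub>H x + h' \<otimes>\<^sub>H (x :: 'm)"
  unfolding tensor_def
  by (rule linear_extension_add) (simp add: poly_mapping_eq_iff lookup_add fun_eq_iff assms)

lemma tensor_add_right: "h \<otimes>\<^sub>H (x + y) = h \<otimes>\<^sub>H x + h \<otimes>\<^sub>H y"
  by (simp add: tensor_def linear_extension_def single_add sum.distrib)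

lemma tensor_hb [simp]: "hb b \<otimes>\<^sub>H x = Poly_Mapping.single b x"
  by (simp add: tensor_def)

lemma tensor_lift_add:
  fixes \<beta> :: "H \<Rightarrow> 'm::ab_group_add \<Rightarrow> 'n::ab_group_add"
  assumes "\<And>h x y. \<beta> h (x + y) = \<beta> h x + \<beta> h y"
  shows "tensor_lift \<beta> (z + z') = tensor_lift \<beta> z + tensor_lift \<beta> z'"
proof -
  let ?U = "Poly_Mapping.keys z \<union> Poly_Mapping.keys z'"
  let ?v = "\<lambda>k b. \<beta> (hb b) (Poly_Mapping.lookup k b)"
  have zero: "\<beta> h 0 = 0" for h using assms[of h 0 0] by simp
  have *: "tensor_lift \<beta> k = (\<Sum>b\<in>?U. ?v k b)" if "Poly_Mapping.keys k \<subseteq> ?U" for k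
    unfolding tensor_lift_def
    by (rule sum.mono_neutral_left) (use that zero in \<open>auto simp: in_keys_iff\<close>)
  show ?thesis
    by (simp add: * keys_add lookup_add assms sum.distrib)
qed

lemma additive_sum:
  fixes \<psi> :: "'x::ab_group_add \<Rightarrow> 'y::ab_group_add"
  assumes "\<And>u v. \<psi> (u + v) = \<psi> u + \<psi> v"
  shows "\<psi> (\<Sum>i\<in>I. t i) = (\<Sum>i\<in>I. \<psi> (t i))"
proof -
  have "\<psi> 0 = 0" using assms[of 0 0] by simp
  then show ?thesis
    by (induction I rule: infinite_finite_induct) (simp_all add: assms)
qed

lemma sum_singles: "(\<Sum>b\<in>Poly_Mapping.keys z. Poly_Mapping.single b (Poly_Mapping.lookup z b)) = z"
  by (rule poly_mapping_eqI) (auto simp: lookup_sum lookup_single when_def in_keys_iff)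

lemma tensor_lift_tensor:
  fixes \<beta> :: "H \<Rightarrow> 'm::ab_group_add \<Rightarrow> 'n::ab_group_add"
  assumes "\<And>h h' x. \<beta> (h + h') x = \<beta> h x + \<beta> h' x"
    and "\<And>h x y. \<beta> h (x + y) = \<beta> h x + \<beta> h y"
  shows "tensor_lift \<beta> (h \<otimes>\<^sub>H x) = \<beta> h x"
proof -
  have zero: "\<beta> h 0 = 0" for h using assms(2)[of h 0 0] by simp
  have "Poly_Mapping.single b (Poly_Mapping.lookup h b) = hb b" if "b \<in> Poly_Mapping.keys h" for b
    using that by (simp add: in_keys_iff)
  then have h: "h = (\<Sum>b\<in>Poly_Mapping.keys h. hb b)"
    using sum_singles[of h] by simp
  have "tensor_lift \<beta> (h \<otimes>\<^sub>H x)
      = (\<Sum>b\<in>Poly_Mapping.keys h. tensor_lift \<beta> (Poly_Mapping.single b x))"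
    unfolding tensor_def linear_extension_def
    by (rule additive_sum) (rule tensor_lift_add, rule assms(2))
  also have "\<dots> = (\<Sum>b\<in>Poly_Mapping.keys h. \<beta> (hb b) x)"
    by (intro sum.cong refl) (cases "x = 0"; simp add: tensor_lift_def zero)
  also have "\<dots> = \<beta> (\<Sum>b\<in>Poly_Mapping.keys h. hb b) x"
    by (rule additive_sum[symmetric]) (rule assms(1))
  finally show ?thesis using h by simp
qed

theorem tensor_universal:
  fixes \<beta> :: "H \<Rightarrow> 'm::ab_group_add \<Rightarrow> 'n::ab_group_add"
  assumes "\<And>h h' x. \<beta> (h + h') x = \<beta> h x + \<beta> h' x"
    and "\<And>h x y. \<beta> h (x + y) = \<beta> h x + \<beta> h y"
  shows "\<exists>!\<psi>. (\<forall>z z'. \<psi> (z + z') = \<psi> z + \<psi> z') \<and> (\<forall>h x. \<psi> (h \<otimes>\<^sub>H x) = \<beta> h x)"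
proof (rule ex1I[of _ "tensor_lift \<beta>"])
  show "(\<forall>z z'. tensor_lift \<beta> (z + z') = tensor_lift \<beta> z + tensor_lift \<beta> z') \<and>
      (\<forall>h x. tensor_lift \<beta> (h \<otimes>\<^sub>H x) = \<beta> h x)"
    using tensor_lift_add[of \<beta>] tensor_lift_tensor[of \<beta>] assms by blast
next
  fix \<psi>
  assume \<psi>: "(\<forall>z z'. \<psi> (z + z') = \<psi> z + \<psi> z') \<and> (\<forall>h x. \<psi> (h \<otimes>\<^sub>H x) = \<beta> h x)"
  show "\<psi> = tensor_lift \<beta>"
  proof
    fix z
    have "\<psi> z = \<psi> (\<Sum>b\<in>Poly_Mapping.keys z. Poly_Mapping.single b (Poly_Mapping.lookup z b))"
      by (simp add: sum_singles)
    also have "\<dots> = (\<Sum>b\<in>Poly_Mapping.keys z. \<psi> (hb b \<otimes>\<^sub>H Poly_Mapping.lookup z b))"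
      using \<psi> by (subst additive_sum) auto
    also have "\<dots> = tensor_lift \<beta> z"
      unfolding tensor_lift_def using \<psi> by metis
    finally show "\<psi> z = tensor_lift \<beta> z" .
  qed
qed


section \<open>The functor \<open>R\<close>\<close>

fun R_op :: "(steenrod, int, 'm::ab_group_add) gmodule \<Rightarrow> egen \<Rightarrow> 'm htensor \<Rightarrow> 'm htensor" where
  "R_op M EQ0 = tensor_lift (\<lambda>h x. H_Q0 h \<otimes>\<^sub>H x + h \<otimes>\<^sub>H act M Q0 x)"
| "R_op M EQ1 = tensor_lift (\<lambda>h x.
     H_Q1 h \<otimes>\<^sub>H x + (H_a \<cdot> H_Q0 h) \<otimes>\<^sub>H act M Q0 x
     + (H_a \<cdot> h) \<otimes>\<^sub>H act M (Sq 2) x + (H_sigma_inv \<cdot> h) \<otimes>\<^sub>H act M Q1 x)"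

definition free_act :: "('g \<Rightarrow> 'm \<Rightarrow> 'm) \<Rightarrow> 'g freealg \<Rightarrow> 'm::ab_group_add \<Rightarrow> 'm" where
  "free_act q p z = (\<Sum>w\<in>Poly_Mapping.keys p. foldr q (letters w) z)"

text \<open>
  An element of \<open>E\<close> acts through any representative in the free algebra on the two generators;
  this is independent of the representative because the two operators square to zero and
  commute.  The degree of \<open>hb b \<otimes>\<^sub>H x\<close> is \<open>hdegree b + (n, 0)\<close> for \<open>x\<close> of degree \<open>n\<close>.
\<close>

definition R :: "(steenrod, int, 'm::ab_group_add) gmodule \<Rightarrow> (E, roq, 'm htensor) gmodule" where
  "R M = \<lparr>act = (\<lambda>e. free_act (R_op M) (rep_exterior e)),
          component = (\<lambda>d. {z. \<forall>b\<in>Poly_Mapping.keys z. \<exists>n.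
             Poly_Mapping.lookup z b \<in> component M n \<and> hdegree b + (n, 0) = d})\<rparr>"

definition R_map :: "('m::ab_group_add \<Rightarrow> 'n::ab_group_add) \<Rightarrow> 'm htensor \<Rightarrow> 'n htensor" where
  "R_map f = tensor_lift (\<lambda>h x. h \<otimes>\<^sub>H f x)"

end

theory Submission
  imports Defs
begin

text \<open>
  An element of \<open>R M\<close> is a finitely supported family of elements of \<open>M\<close> indexed by the basis of
  \<open>H\<close>, and \<open>R_map f\<close> applies \<open>f\<close> to each member of the family.  Injectivity, surjectivity, the
  equality of image and kernel, and the equation \<open>g \<circ> s = id\<close> for a section \<open>s\<close> are therefore
  inherited from \<open>A \<rightarrow> B \<rightarrow> C\<close> one coordinate at a time (\<open>inj_R_map\<close>, \<open>range_R_map\<close>).  The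
  substance lies in two other points.

  First, \<open>R M\<close> has to be a graded module over \<open>\<E>\<close>, that is, the two operators on \<open>H \<otimes> M\<close> must
  square to zero and commute (\<open>R_op_relations\<close>).  Expanding \<open>\<Q>\<^sub>i \<Q>\<^sub>j (h \<otimes> x)\<close> moves \<open>\<Q>\<^sub>0\<close> and
  \<open>\<Q>\<^sub>1\<close> past multiplication by \<open>a\<close> and \<open>\<sigma>\<^sup>-\<^sup>1\<close>.  They commute with \<open>a\<close>, but
  \<open>\<Q>\<^sub>0 (\<sigma>\<^sup>-\<^sup>1 h) = \<sigma>\<^sup>-\<^sup>1 \<Q>\<^sub>0 h + a h\<close> and \<open>\<Q>\<^sub>1 (\<sigma>\<^sup>-\<^sup>1 h) = \<sigma>\<^sup>-\<^sup>1 \<Q>\<^sub>1 h + a\<^sup>2 \<Q>\<^sub>0 h\<close>.  These two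
  error terms cancel against the noncommutativity of \<open>Sq\<^sup>1\<close> and \<open>Sq\<^sup>2\<close>, measured by \<open>Q\<^sub>1\<close>, and
  against \<open>Sq\<^sup>2 Sq\<^sup>2 = Sq\<^sup>1 Sq\<^sup>2 Sq\<^sup>1\<close>.  The remaining terms cancel in pairs or
  vanish, since \<open>Q\<^sub>0\<close> and \<open>Q\<^sub>1\<close> square to zero and \<open>Q\<^sub>1\<close> commutes with \<open>Q\<^sub>0\<close> and \<open>Sq\<^sup>2\<close>.  Additive operators in characteristic two that commute and square to
  zero make the action of the free algebra factor through the exterior algebra
  (\<open>free_act_cong\<close>).

  Second, the splitting.  The formula for \<open>\<Q>\<^sub>0\<close> on \<open>H \<otimes> M\<close> uses from \<open>M\<close> only the action of \<open>Q\<^sub>0\<close>,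
  whereas the one for \<open>\<Q>\<^sub>1\<close> also uses \<open>Sq\<^sup>2\<close>.  Hence applying a \<open>\<Lambda>(Q\<^sub>0)\<close>-linear section in each
  coordinate gives a map that is linear over \<open>\<Lambda>\<^sub>0\<close>, though in general not over \<open>\<E>\<close>
  (\<open>graded_hom_R_map_Lambda0\<close>).
\<close>

section \<open>Characteristic two\<close>

lemma bit_poly_char2: "p + p = (0 :: 'k \<Rightarrow>\<^sub>0 bit)"
  by (rule poly_mapping_eqI) (simp add: lookup_add)

lemma htensor_char2:
  assumes "\<And>x::'m::ab_group_add. x + x = 0"
  shows "z + z = (0 :: 'm htensor)"
  by (rule poly_mapping_eqI) (simp add: lookup_add assms)

lemma poly_mapping_induct [case_names zero single add]:
  fixes p :: "'k \<Rightarrow>\<^sub>0 'm::comm_monoid_add"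
  assumes "P 0" "\<And>k x. P (Poly_Mapping.single k x)"
    and "\<And>p q. P p \<Longrightarrow> P q \<Longrightarrow> P (p + q)"
  shows "P p"
proof -
  have "P (\<Sum>k\<in>K. Poly_Mapping.single k (Poly_Mapping.lookup p k))" for K
    by (induction K rule: infinite_finite_induct) (simp_all add: assms)
  then have "P (\<Sum>k\<in>Poly_Mapping.keys p. Poly_Mapping.single k (Poly_Mapping.lookup p k))" .
  moreover have "(\<Sum>k\<in>Poly_Mapping.keys p. Poly_Mapping.single k (Poly_Mapping.lookup p k)) = p"
    by (rule poly_mapping_eqI) (auto simp: lookup_sum lookup_single when_def in_keys_iff)
  ultimately show ?thesis by simp
qed

lemma bit_poly_induct [case_names zero single add]:
  fixes p :: "'k \<Rightarrow>\<^sub>0 bit"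
  assumes "P 0" "\<And>k. P (Poly_Mapping.single k 1)"
    and "\<And>p q. P p \<Longrightarrow> P q \<Longrightarrow> P (p + q)"
  shows "P p"
proof (induction p rule: poly_mapping_induct)
  fix k :: 'k and v :: bit
  show "P (Poly_Mapping.single k v)"
    using assms(1,2) by (cases v rule: bit.exhaust) simp_all
qed (use assms in auto)

text \<open>
  The square of a sum of commuting operators of square zero consists of mixed products, and
  \<open>T i \<circ> T j\<close> and \<open>T j \<circ> T i\<close> cancel in characteristic two.
\<close>

lemma square_zero_sum:
  fixes T :: "'i \<Rightarrow> 'v::ab_group_add \<Rightarrow> 'v"
  assumes char2: "\<And>v::'v. v + v = 0"
    and add: "\<And>i u v. i \<in> K \<Longrightarrow> T i (u + v) = T i u + T i v"
    and square: "\<And>i v. i \<in> K \<Longrightarrow> T i (T i v) = 0"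
    and commute: "\<And>i j v. i \<in> K \<Longrightarrow> j \<in> K \<Longrightarrow> T i (T j v) = T j (T i v)"
    and "finite K"
  shows "(\<Sum>i\<in>K. T i (\<Sum>j\<in>K. T j z)) = 0"
  using \<open>finite K\<close> add square commute
proof (induction K)
  case empty
  then show ?case by simp
next
  case (insert k K)
  have T_sum: "T i (\<Sum>j\<in>K. T j z) = (\<Sum>j\<in>K. T i (T j z))" if "i \<in> insert k K" for i
    using insert.prems(1) that by (intro additive_sum) blast
  have IH: "(\<Sum>i\<in>K. T i (\<Sum>j\<in>K. T j z)) = 0"
    by (rule insert.IH) (use insert.prems in auto)
  have cross: "(\<Sum>i\<in>K. T i (T k z)) = T k (\<Sum>j\<in>K. T j z)"
    using T_sum[of k] insert.prems(3) by (simp cong: sum.cong)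
  have "(\<Sum>i\<in>K. T i (T k z + (\<Sum>j\<in>K. T j z)))
      = (\<Sum>i\<in>K. T i (T k z) + T i (\<Sum>j\<in>K. T j z))"
    using insert.prems(1) by (intro sum.cong) auto
  then show ?case
    using insert.hyps insert.prems IH cross char2 by (simp add: sum.distrib)
qed


section \<open>Operators on H\<close>

lemma linear_extension_zero [simp]: "linear_extension \<phi> 0 = 0"
  by (simp add: linear_extension_def)

lemma linear_extension_H_add:
  "linear_extension (\<phi> :: hbasis \<Rightarrow> H) (h + h') = linear_extension \<phi> h + linear_extension \<phi> h'"
  by (rule linear_extension_add) (rule bit_poly_char2)

lemma H_a_mult: "H_a \<cdot> h = linear_extension (hbasis_mult (Pos 1 0)) h"
  by (simp add: hmult_def H_a_def)

lemma H_sigma_inv_mult: "H_sigma_inv \<cdot> h = linear_extension (hbasis_mult (Pos 0 1)) h"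
  by (simp add: hmult_def H_sigma_inv_def)

lemmas H_operator_defs = H_Q0_def H_Q1_def H_a_mult H_sigma_inv_mult

lemma H_operator_zero [simp]:
  "H_Q0 0 = 0" "H_Q1 0 = 0" "H_a \<cdot> 0 = 0" "H_sigma_inv \<cdot> 0 = 0"
  by (simp_all add: H_operator_defs)

lemma H_operator_add:
  "H_Q0 (h + h') = H_Q0 h + H_Q0 h'"
  "H_Q1 (h + h') = H_Q1 h + H_Q1 h'"
  "H_a \<cdot> (h + h') = H_a \<cdot> h + H_a \<cdot> h'"
  "H_sigma_inv \<cdot> (h + h') = H_sigma_inv \<cdot> h + H_sigma_inv \<cdot> h'"
  by (simp_all add: H_operator_defs linear_extension_H_add)

lemma H_operator_hb:
  "H_Q0 (hb b) = hbasis_Q0 b" "H_Q1 (hb b) = hbasis_Q1 b"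
  "H_a \<cdot> hb b = hbasis_mult (Pos 1 0) b" "H_sigma_inv \<cdot> hb b = hbasis_mult (Pos 0 1) b"
  by (simp_all add: H_operator_defs)

lemma hb_eq_iff: "hb b = hb b' \<longleftrightarrow> b = b'"
  by (metis lookup_single_eq lookup_single_not_eq zero_neq_one)

lemma H_Q0_Q0: "H_Q0 (H_Q0 h) = 0"
proof (induction h rule: bit_poly_induct)
  case (single b)
  then show ?case by (cases b) (auto simp: H_operator_hb)
qed (simp_all add: H_operator_add)

text \<open>
  Whether \<open>\<Q>\<^sub>0\<close> and \<open>\<Q>\<^sub>1\<close> kill a monomial depends only on residues modulo \<open>4\<close> of the exponent of
  \<open>\<sigma>\<close>, apart from the bounds on exponents.  Writing that exponent with explicit successors lets the
  simplifier decide all these conditions and evaluate the truncated subtractions.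
\<close>

lemma mod_4_cases:
  fixes n :: nat
  obtains q where "n = 4 * q" | q where "n = Suc (4 * q)"
  | q where "n = Suc (Suc (4 * q))" | q where "n = Suc (Suc (Suc (4 * q)))"
proof -
  have n: "n = 4 * (n div 4) + n mod 4" by simp
  consider "n mod 4 = 0" | "n mod 4 = 1" | "n mod 4 = 2" | "n mod 4 = 3" by linarith
  then show thesis
  proof cases
    case 1
    with n show thesis by (intro that(1)[of "n div 4"]) linarith
  next
    case 2
    with n show thesis by (intro that(2)[of "n div 4"]) linarith
  next
    case 3
    with n show thesis by (intro that(3)[of "n div 4"]) linarith
  next
    case 4
    with n show thesis by (intro that(4)[of "n div 4"]) linarith
  qed
qed

text \<open>
  A nonzero application of \<open>\<Q>\<^sub>1\<close> takes a \<open>\<sigma>\<close>-exponent congruent to \<open>2\<close> or \<open>3\<close> in absolute value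
  to one congruent to \<open>0\<close> or \<open>1\<close>, where \<open>\<Q>\<^sub>1\<close> vanishes.
\<close>

lemma H_Q1_Q1: "H_Q1 (H_Q1 h) = 0"
proof (induction h rule: bit_poly_induct)
  case (single b)
  show ?case
  proof (cases b)
    case (Pos k n)
    then show ?thesis
      by (cases n rule: mod_4_cases)
        (auto simp: H_operator_hb mod_Suc hb_eq_iff bit_poly_char2 numeral_3_eq_3)
  next
    case (Neg k l)
    then show ?thesis
      by (cases l rule: mod_4_cases)
        (auto simp: H_operator_hb mod_Suc hb_eq_iff bit_poly_char2 numeral_3_eq_3)
  qed
qed (simp_all add: H_operator_add)

lemma H_Q1_Q0: "H_Q1 (H_Q0 h) = H_Q0 (H_Q1 h)"
proof (induction h rule: bit_poly_induct)
  case (single b)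
  show ?case
  proof (cases b)
    case (Pos k n)
    then show ?thesis
      by (cases n rule: mod_4_cases)
        (auto simp: H_operator_hb mod_Suc hb_eq_iff bit_poly_char2 numeral_3_eq_3)
  next
    case (Neg k l)
    then show ?thesis
      by (cases l rule: mod_4_cases)
        (auto simp: H_operator_hb mod_Suc hb_eq_iff bit_poly_char2 numeral_3_eq_3)
  qed
qed (simp_all add: H_operator_add)

lemma H_sigma_inv_a: "H_sigma_inv \<cdot> (H_a \<cdot> h) = H_a \<cdot> (H_sigma_inv \<cdot> h)"
proof (induction h rule: bit_poly_induct)
  case (single b)
  then show ?case by (cases b) (auto simp: H_operator_hb)
qed (simp_all add: H_operator_add)

lemma H_Q0_a: "H_Q0 (H_a \<cdot> h) = H_a \<cdot> H_Q0 h"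
proof (induction h rule: bit_poly_induct)
  case (single b)
  then show ?case by (cases b) (auto simp: H_operator_hb)
qed (simp_all add: H_operator_add)

lemma H_Q1_a: "H_Q1 (H_a \<cdot> h) = H_a \<cdot> H_Q1 h"
proof (induction h rule: bit_poly_induct)
  case (single b)
  then show ?case by (cases b) (auto simp: H_operator_hb hb_eq_iff)
qed (simp_all add: H_operator_add)

text \<open>
  For a monomial \<open>h\<close>, multiplication by \<open>\<sigma>\<^sup>-\<^sup>1\<close> changes the parity that decides whether \<open>\<Q>\<^sub>0\<close>
  vanishes.  So one of \<open>\<Q>\<^sub>0 (\<sigma>\<^sup>-\<^sup>1 h)\<close> and \<open>\<sigma>\<^sup>-\<^sup>1 \<Q>\<^sub>0 h\<close> is \<open>0\<close>, and the other is \<open>a h\<close>.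
\<close>

lemma H_Q0_sigma_inv: "H_Q0 (H_sigma_inv \<cdot> h) = H_sigma_inv \<cdot> H_Q0 h + H_a \<cdot> h"
proof (induction h rule: bit_poly_induct)
  case (single b)
  show ?case
  proof (cases b)
    case (Pos k n)
    then show ?thesis by (auto simp: H_operator_hb bit_poly_char2)
  next
    case (Neg k l)
    then show ?thesis
      by (cases l) (auto simp: H_operator_hb bit_poly_char2)
  qed
qed (simp_all add: H_operator_add)

text \<open>
  Up to the bounds on exponents, \<open>\<Q>\<^sub>1 h\<close> and \<open>\<Q>\<^sub>1 (\<sigma>\<^sup>-\<^sup>1 h)\<close> are each nonzero for two residues modulo
  \<open>4\<close> of the \<open>\<sigma>\<close>-exponent of the monomial \<open>h\<close>.  One residue is common to both and contributes
  nothing to the difference; the other two are the residues at which \<open>\<Q>\<^sub>0 h\<close> is nonzero.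
\<close>

lemma H_Q1_sigma_inv: "H_Q1 (H_sigma_inv \<cdot> h) = H_sigma_inv \<cdot> H_Q1 h + H_a \<cdot> (H_a \<cdot> H_Q0 h)"
proof (induction h rule: bit_poly_induct)
  case (single b)
  show ?case
  proof (cases b)
    case (Pos k n)
    then show ?thesis
      by (cases n rule: mod_4_cases)
        (auto simp: H_operator_hb mod_Suc hb_eq_iff bit_poly_char2 numeral_3_eq_3)
  next
    case (Neg k l)
    then show ?thesis
      by (cases l rule: mod_4_cases)
        (auto simp: H_operator_hb mod_Suc hb_eq_iff bit_poly_char2 numeral_3_eq_3)
  qed
qed (simp_all add: H_operator_add)

definition H_homogeneous :: "roq \<Rightarrow> H set" where
  "H_homogeneous d = {h. \<forall>b\<in>Poly_Mapping.keys h. hdegree b = d}"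

lemma H_homogeneous_zero: "0 \<in> H_homogeneous d"
  by (simp add: H_homogeneous_def)

lemma H_homogeneous_add:
  "h \<in> H_homogeneous d \<Longrightarrow> h' \<in> H_homogeneous d \<Longrightarrow> h + h' \<in> H_homogeneous d"
  using keys_add[of h h'] by (auto simp: H_homogeneous_def)

lemma H_homogeneous_linear_extension:
  assumes "\<And>b. \<phi> b \<in> H_homogeneous (k + hdegree b)" and "h \<in> H_homogeneous d"
  shows "linear_extension \<phi> h \<in> H_homogeneous (k + d)"
proof -
  have "(\<Sum>b\<in>K. \<phi> b) \<in> H_homogeneous (k + d)" if "K \<subseteq> Poly_Mapping.keys h" for K
    using that
  proof (induction K rule: infinite_finite_induct)
    case (insert b K)
    then have "hdegree b = d" using assms(2) by (simp add: H_homogeneous_def)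
    with insert show ?case using assms(1)[of b] by (simp add: H_homogeneous_add)
  qed (simp_all add: H_homogeneous_zero)
  then show ?thesis by (simp add: linear_extension_def)
qed

lemma H_operator_homogeneous:
  assumes "h \<in> H_homogeneous d"
  shows "H_Q0 h \<in> H_homogeneous ((1, 0) + d)" "H_Q1 h \<in> H_homogeneous ((2, 1) + d)"
    "H_a \<cdot> h \<in> H_homogeneous ((0, 1) + d)" "H_sigma_inv \<cdot> h \<in> H_homogeneous ((-1, 1) + d)"
proof -
  have "hbasis_Q0 b \<in> H_homogeneous ((1, 0) + hdegree b)" for b
    by (cases b) (auto simp: H_homogeneous_def elim: oddE)
  moreover have "hbasis_Q1 b \<in> H_homogeneous ((2, 1) + hdegree b)" for b
  proof (cases b)
    case (Pos k n)
    have "n \<ge> 2" if "n mod 4 \<in> {2, 3}" using that by (cases "n < 2") (auto simp: less_2_cases_iff)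
    then show ?thesis using Pos by (auto simp: H_homogeneous_def)
  qed (auto simp: H_homogeneous_def)
  moreover have "hbasis_mult (Pos 1 0) b \<in> H_homogeneous ((0, 1) + hdegree b)" for b
    by (cases b) (auto simp: H_homogeneous_def)
  moreover have "hbasis_mult (Pos 0 1) b \<in> H_homogeneous ((-1, 1) + hdegree b)" for b
    by (cases b) (auto simp: H_homogeneous_def)
  ultimately show "H_Q0 h \<in> H_homogeneous ((1, 0) + d)" "H_Q1 h \<in> H_homogeneous ((2, 1) + d)"
    "H_a \<cdot> h \<in> H_homogeneous ((0, 1) + d)" "H_sigma_inv \<cdot> h \<in> H_homogeneous ((-1, 1) + d)"
    using H_homogeneous_linear_extension assms by (simp_all only: H_operator_defs)
qed


section \<open>Relations in A(1)\<close>

lemma steenrod_abs_eqI: "p - q \<in> adem_relations \<Longrightarrow> abs_steenrod p = abs_steenrod q"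
  using two_sided_ideal.gen[of "p - q" adem_relations 1 1]
  by (simp add: steenrod.abs_eq_iff ideal_cong_def)

lemma Sq_0: "Sq 0 = 1"
  unfolding Sq.abs_eq one_steenrod.abs_eq
  by (rule steenrod_abs_eqI) (simp add: adem_relations_def)

lemma adem:
  assumes "0 < i" "i < 2 * j"
  shows "Sq i * Sq j = abs_steenrod (\<Sum>k = 0..i div 2.
    of_nat ((j - k - 1) choose (i - 2 * k)) * (letter (i + j - k) * letter k))"
  unfolding Sq.abs_eq times_steenrod.abs_eq
  by (rule steenrod_abs_eqI) (use assms in \<open>unfold adem_relations_def, blast\<close>)

lemma Sq_1_1: "Sq 1 * Sq 1 = 0"
  by (subst adem) (simp_all add: zero_steenrod.abs_eq)

lemma Sq_1_2: "Sq 1 * Sq 2 = Sq 3"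
proof -
  have "Sq 1 * Sq 2 = Sq 3 * Sq 0"
    by (subst adem) (simp_all add: Sq.abs_eq times_steenrod.abs_eq eval_nat_numeral)
  then show ?thesis by (simp add: Sq_0)
qed

text \<open>
  The Adem relation produces \<open>Sq\<^sup>3 Sq\<^sup>1\<close>; the square \<open>Sq\<^sup>3\<close> is eliminated in favour of the
  generators of \<open>A(1)\<close>.
\<close>

lemma Sq_2_2: "Sq 2 * Sq 2 = Sq 1 * Sq 2 * Sq 1"
proof -
  have "Sq 2 * Sq 2 = Sq 3 * Sq 1"
    by (subst adem) (simp_all add: Sq.abs_eq times_steenrod.abs_eq eval_nat_numeral)
  then show ?thesis by (simp only: Sq_1_2)
qed

lemma steenrod_char2: "1 + 1 = (0 :: steenrod)"
  by (simp add: one_steenrod.abs_eq zero_steenrod.abs_eq plus_steenrod.abs_eq bit_poly_char2)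


section \<open>Actions of a free algebra that factor through an exterior algebra\<close>

lemma free_act_single [simp]: "free_act q (Poly_Mapping.single w 1) z = foldr q (letters w) z"
  by (simp add: free_act_def)

lemma free_act_add:
  fixes q :: "'g \<Rightarrow> 'v::ab_group_add \<Rightarrow> 'v"
  assumes char2: "\<And>v::'v. v + v = 0"
  shows "free_act q (p + p') z = free_act q p z + free_act q p' z"
proof -
  let ?U = "Poly_Mapping.keys p \<union> Poly_Mapping.keys p'"
  let ?v = "\<lambda>p w. if Poly_Mapping.lookup p w = 0 then 0 else foldr q (letters w) z"
  have extend: "free_act q r z = (\<Sum>w\<in>?U. ?v r w)" if "Poly_Mapping.keys r \<subseteq> ?U" for r
    unfolding free_act_def
    by (rule sum.mono_neutral_cong_left) (use that in \<open>auto simp: in_keys_iff\<close>)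
  have "?v (p + p') w = ?v p w + ?v p' w" for w
    using char2[of "foldr q (letters w) z"] by (auto simp: lookup_add)
  then show ?thesis
    using extend[OF keys_add] by (simp add: extend sum.distrib)
qed

lemma free_act_zero [simp]: "free_act q 0 z = 0"
  by (simp add: free_act_def)

locale exterior_operators =
  fixes q :: "'g \<Rightarrow> 'v::ab_group_add \<Rightarrow> 'v"
  assumes target_char2: "v + v = (0::'v)"
    and q_add: "q i (u + v) = q i u + q i v"
    and q_square: "q i (q i v) = 0"
    and q_commute: "q i (q j v) = q j (q i v)"
begin

lemma foldr_q_add: "foldr q gs (u + v) = foldr q gs u + foldr q gs v"
  by (induction gs) (simp_all add: q_add)

lemma free_act_add_right: "free_act q p (u + v) = free_act q p u + free_act q p v"
  by (simp add: free_act_def foldr_q_add sum.distrib)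

lemma free_act_zero_right: "free_act q p 0 = 0"
  using free_act_add_right[of p 0 0] by simp

lemma free_act_mult: "free_act q (p * p') z = free_act q p (free_act q p' z)"
proof (induction p rule: bit_poly_induct)
  case (single w)
  show ?case
  proof (induction p' rule: bit_poly_induct)
    case (single w')
    then show ?case by (simp add: mult_single plus_word_def)
  next
    case (add p p')
    then show ?case by (simp add: distrib_left free_act_add[OF target_char2] foldr_q_add)
  qed (use free_act_zero_right[of "Poly_Mapping.single w 1"] in simp)
qed (simp_all add: distrib_right free_act_add[OF target_char2])

text \<open>
  An element of the generating vector space acts as a sum of generators, hence as a sum of
  commuting operators of square zero.
\<close>

lemma free_act_exterior_relations:
  assumes "p \<in> exterior_relations"
  shows "free_act q p z = 0"
proof -
  obtain v where v: "p = v * v" "\<And>w. w \<in> Poly_Mapping.keys v \<Longrightarrow> length (letters w) = 1"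
    using assms by (auto simp: exterior_relations_def)
  have one: "\<exists>g. letters w = [g]" if "w \<in> Poly_Mapping.keys v" for w
    using v(2)[OF that] by (cases "letters w") auto
  have "(\<Sum>i\<in>Poly_Mapping.keys v. foldr q (letters i)
      (\<Sum>j\<in>Poly_Mapping.keys v. foldr q (letters j) z)) = 0"
  proof (rule square_zero_sum)
    show "foldr q (letters i) (foldr q (letters i) u) = 0" if "i \<in> Poly_Mapping.keys v" for i u
      using one[OF that] by (auto simp: q_square)
    show "foldr q (letters i) (foldr q (letters j) u) = foldr q (letters j) (foldr q (letters i) u)"
      if "i \<in> Poly_Mapping.keys v" "j \<in> Poly_Mapping.keys v" for i j u
      using one[OF that(1)] one[OF that(2)] by (auto simp: q_commute)
  qed (simp_all add: target_char2 foldr_q_add)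
  then show ?thesis
    unfolding v(1) free_act_mult by (simp add: free_act_def)
qed

lemma free_act_exterior_ideal:
  assumes "p \<in> two_sided_ideal exterior_relations"
  shows "free_act q p z = 0"
  using assms
  by (induction arbitrary: z)
    (simp_all add: free_act_mult free_act_exterior_relations free_act_zero_right free_act_add[OF target_char2])

lemma free_act_cong:
  assumes "ideal_cong exterior_relations p p'"
  shows "free_act q p z = free_act q p' z"
proof -
  have "free_act q (p - p') z = 0"
    using assms by (simp add: ideal_cong_def free_act_exterior_ideal)
  then show ?thesis
    using free_act_add[OF target_char2, of q "p - p'" p' z] by simp
qed

lemma free_act_rep_abs: "free_act q (rep_exterior (abs_exterior p)) z = free_act q p z"
  by (rule free_act_cong, rule Quotient3_rep_abs[OF Quotient3_exterior])
    (rule equivp_reflp[OF equivp_ideal_cong])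

end


section \<open>Direct sums of graded groups\<close>

lemma is_grading_subgroup:
  assumes "is_grading N"
  shows "0 \<in> N d" "x \<in> N d \<Longrightarrow> y \<in> N d \<Longrightarrow> x - y \<in> N d" "x \<in> N d \<Longrightarrow> y \<in> N d \<Longrightarrow> x + y \<in> N d"
proof -
  show zero: "0 \<in> N d" and diff: "x \<in> N d \<Longrightarrow> y \<in> N d \<Longrightarrow> x - y \<in> N d" for x y
    using assms by (auto simp: is_grading_def)
  show "x \<in> N d \<Longrightarrow> y \<in> N d \<Longrightarrow> x + y \<in> N d"
    using diff[of x "0 - y"] diff[OF zero] by simp
qed

text \<open>
  This is the condition under the unique existence quantifier of \<^const>\<open>is_grading\<close>.  It has a
  name because existence and uniqueness pass to direct sums for different reasons.
\<close>

definition decomposes :: "('d \<Rightarrow> 'm::ab_group_add set) \<Rightarrow> 'm \<Rightarrow> ('d \<Rightarrow> 'm) \<Rightarrow> bool" where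
  "decomposes N x c \<longleftrightarrow>
     (\<forall>d. c d \<in> N d) \<and> finite {d. c d \<noteq> 0} \<and> x = (\<Sum>d | c d \<noteq> 0. c d)"

lemma decomposesI:
  assumes "\<And>d. c d \<in> N d" "finite F" "\<And>d. d \<notin> F \<Longrightarrow> c d = 0" "x = sum c F"
  shows "decomposes N x c"
proof -
  have "{d. c d \<noteq> 0} \<subseteq> F" using assms(3) by auto
  moreover from this have "sum c F = (\<Sum>d | c d \<noteq> 0. c d)"
    using assms(2) by (intro sum.mono_neutral_right) auto
  ultimately show ?thesis
    using assms finite_subset by (auto simp: decomposes_def)
qed

lemma is_grading_iff:
  "is_grading N \<longleftrightarrow>
     (\<forall>d. 0 \<in> N d \<and> (\<forall>x\<in>N d. \<forall>y\<in>N d. x - y \<in> N d)) \<and> (\<forall>x. \<exists>!c. decomposes N x c)"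
  by (simp only: is_grading_def decomposes_def)

lemma decomposes_unique:
  "is_grading N \<Longrightarrow> decomposes N x c \<Longrightarrow> decomposes N x c' \<Longrightarrow> c = c'"
  unfolding is_grading_iff by blast

text \<open>
  The summand of index \<open>b\<close> is a copy of the graded group \<open>N\<close> regraded along \<open>\<delta> b\<close>.  The tensor
  product \<open>H \<otimes> M\<close> is the case \<open>\<delta> b n = |b| + n\<close>.  Injectivity of each \<open>\<delta> b\<close> ensures that regrading
  does not merge components.
\<close>

definition direct_sum_grading ::
  "('b \<Rightarrow> 'n \<Rightarrow> 'd) \<Rightarrow> ('n \<Rightarrow> 'm::ab_group_add set) \<Rightarrow> 'd \<Rightarrow> ('b \<Rightarrow>\<^sub>0 'm) set" where
  "direct_sum_grading \<delta> N d =
     {z. \<forall>b\<in>Poly_Mapping.keys z. \<exists>n. Poly_Mapping.lookup z b \<in> N n \<and> \<delta> b n = d}"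

lemma direct_sum_grading_single:
  "x \<in> N n \<Longrightarrow> \<delta> b n = d \<Longrightarrow> Poly_Mapping.single b x \<in> direct_sum_grading \<delta> N d"
  by (auto simp: direct_sum_grading_def lookup_single when_def split: if_splits)

lemma direct_sum_grading_zero: "0 \<in> direct_sum_grading \<delta> N d"
  by (simp add: direct_sum_grading_def)

context
  fixes \<delta> :: "'b \<Rightarrow> 'n \<Rightarrow> 'd" and N :: "'n \<Rightarrow> 'm::ab_group_add set"
  assumes grading: "is_grading N" and inj: "\<And>b. inj (\<delta> b)"
begin

lemma direct_sum_grading_lookup:
  "z \<in> direct_sum_grading \<delta> N (\<delta> b n) \<Longrightarrow> Poly_Mapping.lookup z b \<in> N n"
proof (cases "b \<in> Poly_Mapping.keys z")
  case True
  moreover assume "z \<in> direct_sum_grading \<delta> N (\<delta> b n)"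
  ultimately obtain n' where "Poly_Mapping.lookup z b \<in> N n'" "\<delta> b n' = \<delta> b n"
    unfolding direct_sum_grading_def by blast
  then show ?thesis using injD[OF inj] by metis
qed (simp add: in_keys_iff is_grading_subgroup(1)[OF grading])

lemma direct_sum_grading_iff:
  "z \<in> direct_sum_grading \<delta> N d \<longleftrightarrow>
    (\<forall>b. Poly_Mapping.lookup z b = 0 \<or> (\<exists>n. \<delta> b n = d \<and> Poly_Mapping.lookup z b \<in> N n))"
  by (auto simp: direct_sum_grading_def in_keys_iff)

lemma direct_sum_grading_diff:
  assumes "z \<in> direct_sum_grading \<delta> N d" "z' \<in> direct_sum_grading \<delta> N d"
  shows "z - z' \<in> direct_sum_grading \<delta> N d"
  unfolding direct_sum_grading_iff
proof
  fix b
  show "Poly_Mapping.lookup (z - z') b = 0 \<or>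
      (\<exists>n. \<delta> b n = d \<and> Poly_Mapping.lookup (z - z') b \<in> N n)"
  proof (cases "\<exists>n. \<delta> b n = d")
    case True
    then obtain n where "\<delta> b n = d" ..
    with assms direct_sum_grading_lookup is_grading_subgroup(2)[OF grading] show ?thesis
      by (metis lookup_minus)
  next
    case False
    with assms show ?thesis
      unfolding direct_sum_grading_iff by (metis diff_self lookup_minus)
  qed
qed

lemma direct_sum_grading_add:
  assumes "z \<in> direct_sum_grading \<delta> N d" "z' \<in> direct_sum_grading \<delta> N d"
  shows "z + z' \<in> direct_sum_grading \<delta> N d"
  using direct_sum_grading_diff[OF assms(1) direct_sum_grading_diff[OF direct_sum_grading_zero assms(2)]]
  by simp

lemma direct_sum_decomposition_ex: "\<exists>c. decomposes (direct_sum_grading \<delta> N) z c"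
proof (induction z rule: poly_mapping_induct)
  case zero
  have "decomposes (direct_sum_grading \<delta> N) 0 (\<lambda>d. 0)"
    by (rule decomposesI[where F = "{}"]) (simp_all add: direct_sum_grading_zero)
  then show ?case by blast
next
  case (single b x)
  obtain c where c: "\<And>n. c n \<in> N n" "finite {n. c n \<noteq> 0}" "x = (\<Sum>n | c n \<noteq> 0. c n)"
  proof -
    obtain c where "decomposes N x c" using grading unfolding is_grading_iff by blast
    with that show thesis unfolding decomposes_def by blast
  qed
  \<comment> \<open>The component of \<open>x\<close> of degree \<open>n\<close>, placed in degree \<open>\<delta> b n\<close>.\<close>
  define c' where "c' d = (if d \<in> range (\<delta> b) then Poly_Mapping.single b (c (inv (\<delta> b) d)) else 0)" for d
  have c'_\<delta>: "c' (\<delta> b n) = Poly_Mapping.single b (c n)" for n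
    by (simp add: c'_def inv_f_f[OF inj])
  have "decomposes (direct_sum_grading \<delta> N) (Poly_Mapping.single b x) c'"
  proof (rule decomposesI[where F = "\<delta> b ` {n. c n \<noteq> 0}"])
    show "c' d \<in> direct_sum_grading \<delta> N d" for d
    proof (cases "d \<in> range (\<delta> b)")
      case True
      then show ?thesis using direct_sum_grading_single[of "c _" N, OF c(1) refl] by (auto simp: c'_\<delta>)
    qed (simp add: c'_def direct_sum_grading_zero)
    show "c' d = 0" if "d \<notin> \<delta> b ` {n. c n \<noteq> 0}" for d
    proof (cases "d \<in> range (\<delta> b)")
      case True
      then obtain n where "d = \<delta> b n" by blast
      with that show ?thesis by (cases "c n = 0") (auto simp: c'_\<delta>)
    qed (simp add: c'_def)
    have "sum c' (\<delta> b ` {n. c n \<noteq> 0}) = (\<Sum>n | c n \<noteq> 0. Poly_Mapping.single b (c n))"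
      using inj_on_subset[OF inj] by (subst sum.reindex) (auto simp: c'_\<delta>)
    also have "\<dots> = Poly_Mapping.single b (\<Sum>n | c n \<noteq> 0. c n)"
      by (rule additive_sum[symmetric]) (rule single_add)
    finally show "Poly_Mapping.single b x = sum c' (\<delta> b ` {n. c n \<noteq> 0})"
      using c(3) by simp
  qed (use c(2) in simp)
  then show ?case by blast
next
  case (add z z')
  then obtain c c' where "decomposes (direct_sum_grading \<delta> N) z c"
    and "decomposes (direct_sum_grading \<delta> N) z' c'" by blast
  then have c: "\<And>d. c d \<in> direct_sum_grading \<delta> N d" "finite {d. c d \<noteq> 0}" "z = (\<Sum>d | c d \<noteq> 0. c d)"
    and c': "\<And>d. c' d \<in> direct_sum_grading \<delta> N d" "finite {d. c' d \<noteq> 0}" "z' = (\<Sum>d | c' d \<noteq> 0. c' d)"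
    by (simp_all only: decomposes_def)
  let ?F = "{d. c d \<noteq> 0} \<union> {d. c' d \<noteq> 0}"
  have "decomposes (direct_sum_grading \<delta> N) (z + z') (\<lambda>d. c d + c' d)"
  proof (rule decomposesI[where F = ?F])
    have "z = sum c ?F" "z' = sum c' ?F"
      unfolding c(3) c'(3) using c(2) c'(2) by (intro sum.mono_neutral_left; auto)+
    then show "z + z' = (\<Sum>d\<in>?F. c d + c' d)" by (simp add: sum.distrib)
  qed (use c c' in \<open>auto intro: direct_sum_grading_add\<close>)
  then show ?case by blast
qed

text \<open>
  Uniqueness of decompositions reduces to uniqueness in \<open>N\<close>, because the coordinates at \<open>b\<close> of the
  components of \<open>z\<close> are the components of the coordinate of \<open>z\<close> at \<open>b\<close>: in a degree outside the
  range of \<open>\<delta> b\<close> that coordinate vanishes.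
\<close>

lemma direct_sum_decomposition_lookup:
  assumes "decomposes (direct_sum_grading \<delta> N) z c"
  shows "decomposes N (Poly_Mapping.lookup z b) (\<lambda>n. Poly_Mapping.lookup (c (\<delta> b n)) b)"
proof -
  let ?F = "{d. c d \<noteq> 0}"
  have c: "\<And>d. c d \<in> direct_sum_grading \<delta> N d" "finite ?F" "z = sum c ?F"
    using assms by (simp_all only: decomposes_def)
  show ?thesis
  proof (rule decomposesI[where F = "\<delta> b -` ?F"])
    show "finite (\<delta> b -` ?F)"
      using c(2) inj by (rule finite_vimageI)
    have "Poly_Mapping.lookup z b = (\<Sum>d\<in>?F. Poly_Mapping.lookup (c d) b)"
      by (simp add: c(3) lookup_sum)
    also have "\<dots> = (\<Sum>d\<in>?F \<inter> range (\<delta> b). Poly_Mapping.lookup (c d) b)"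
    proof (rule sum.mono_neutral_right)
      show "\<forall>d\<in>?F - ?F \<inter> range (\<delta> b). Poly_Mapping.lookup (c d) b = 0"
        using c(1) unfolding direct_sum_grading_iff by blast
    qed (use c(2) in auto)
    also have "?F \<inter> range (\<delta> b) = \<delta> b ` (\<delta> b -` ?F)" by auto
    also have "(\<Sum>d\<in>\<dots>. Poly_Mapping.lookup (c d) b) =
        (\<Sum>n\<in>\<delta> b -` ?F. Poly_Mapping.lookup (c (\<delta> b n)) b)"
      using inj_on_subset[OF inj] by (subst sum.reindex) auto
    finally show "Poly_Mapping.lookup z b = \<dots>" .
  qed (use c(1) direct_sum_grading_lookup in auto)
qed

lemma is_grading_direct_sum: "is_grading (direct_sum_grading \<delta> N)"
proof -
  have unique: "c = c'" if "decomposes (direct_sum_grading \<delta> N) z c"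
    "decomposes (direct_sum_grading \<delta> N) z c'" for z c c'
  proof (intro ext poly_mapping_eqI)
    fix d b
    show "Poly_Mapping.lookup (c d) b = Poly_Mapping.lookup (c' d) b"
    proof (cases "d \<in> range (\<delta> b)")
      case True
      then obtain n where "d = \<delta> b n" by blast
      moreover have "(\<lambda>n. Poly_Mapping.lookup (c (\<delta> b n)) b) = (\<lambda>n. Poly_Mapping.lookup (c' (\<delta> b n)) b)"
        by (rule decomposes_unique[OF grading that[THEN direct_sum_decomposition_lookup]])
      ultimately show ?thesis by (auto dest: fun_cong)
    next
      case False
      moreover have "c d \<in> direct_sum_grading \<delta> N d" "c' d \<in> direct_sum_grading \<delta> N d"
        using that by (auto simp: decomposes_def)
      ultimately have "Poly_Mapping.lookup (c d) b = 0" "Poly_Mapping.lookup (c' d) b = 0"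
        unfolding direct_sum_grading_iff by blast+
      then show ?thesis by simp
    qed
  qed
  have "\<exists>!c. decomposes (direct_sum_grading \<delta> N) z c" for z
    using direct_sum_decomposition_ex unique by blast
  then show ?thesis
    by (simp add: is_grading_iff direct_sum_grading_zero direct_sum_grading_diff)
qed

end


section \<open>Modules over A(1)\<close>

lemma A1_closed:
  "Sq 1 \<in> A1" "Sq 2 \<in> A1" "Q0 \<in> A1" "Q1 \<in> A1" "0 \<in> A1" "1 \<in> A1"
  "r \<in> A1 \<Longrightarrow> s \<in> A1 \<Longrightarrow> r + s \<in> A1" "r \<in> A1 \<Longrightarrow> s \<in> A1 \<Longrightarrow> r * s \<in> A1"
proof -
  show Sq: "Sq 1 \<in> A1" "Sq 2 \<in> A1" and one: "1 \<in> A1"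
    and mult: "r \<in> A1 \<Longrightarrow> s \<in> A1 \<Longrightarrow> r * s \<in> A1" for r s
    by (auto simp: A1_def intro: generated_subalgebra.intros)
  have diff: "r \<in> A1 \<Longrightarrow> s \<in> A1 \<Longrightarrow> r - s \<in> A1" for r s
    by (simp add: A1_def generated_subalgebra.diff)
  show zero: "0 \<in> A1" using diff[OF one one] by simp
  show add: "r \<in> A1 \<Longrightarrow> s \<in> A1 \<Longrightarrow> r + s \<in> A1" for r s
    using diff[of r "0 - s"] diff[OF zero] by simp
  show "Q0 \<in> A1" using Sq(1) by (simp add: Q0_def)
  show "Q1 \<in> A1" unfolding Q1_def by (intro add mult Sq)
qed

lemma Sq_homogeneous: "Sq n \<in> steenrod_homogeneous (int n)"
  unfolding steenrod_homogeneous_def Sq.abs_eq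
  by (rule imageI) (simp add: free_homogeneous_def letter_def word_degree_def)

lemma Q0_homogeneous: "Q0 \<in> steenrod_homogeneous 1"
  using Sq_homogeneous[of 1] by (simp add: Q0_def)

lemma Q1_homogeneous: "Q1 \<in> steenrod_homogeneous 3"
proof -
  have "Q1 = abs_steenrod (letter 1 * letter 2 + letter 2 * letter 1)"
    by (simp add: Q1_def Sq.abs_eq times_steenrod.abs_eq plus_steenrod.abs_eq)
  moreover have "letter 1 * letter 2 + letter 2 * letter (1::nat) \<in> free_homogeneous int 3"
    using keys_add[of "letter 1 * letter 2" "letter 2 * letter (1::nat)"]
    by (auto simp: free_homogeneous_def letter_def mult_single word_degree_def plus_word_def)
  ultimately show ?thesis by (auto simp: steenrod_homogeneous_def)
qed

definition htensor_degree :: "hbasis \<Rightarrow> int \<Rightarrow> roq" where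
  "htensor_degree b n = hdegree b + (n, 0)"

lemma component_R: "component (R M) = direct_sum_grading htensor_degree (component M)"
  by (simp add: R_def fun_eq_iff direct_sum_grading_def htensor_degree_def)

lemma inj_htensor_degree: "inj (htensor_degree b)"
  by (auto simp: inj_def htensor_degree_def)

lemma tensor_homogeneous:
  assumes "is_grading N" "h \<in> H_homogeneous e" "x \<in> N n" "e + (n, 0) = d"
  shows "h \<otimes>\<^sub>H x \<in> direct_sum_grading htensor_degree N d"
proof -
  have "(\<Sum>b\<in>K. Poly_Mapping.single b x) \<in> direct_sum_grading htensor_degree N d"
    if "K \<subseteq> Poly_Mapping.keys h" for K
    using that
  proof (induction K rule: infinite_finite_induct)
    case (insert b K)
    then have "htensor_degree b n = d"
      using assms(2,4) by (auto simp: H_homogeneous_def htensor_degree_def)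
    with insert assms(3) show ?case
      by (simp add: direct_sum_grading_add[OF assms(1) inj_htensor_degree]
          direct_sum_grading_single[where n = n])
  qed (simp_all add: direct_sum_grading_zero)
  then show ?thesis by (simp add: tensor_def linear_extension_def)
qed

declare R_op.simps [simp del]

locale a1_module =
  fixes M :: "(steenrod, int, 'm::ab_group_add) gmodule"
  assumes module: "graded_module A1 steenrod_homogeneous M"
begin

abbreviation "q0 \<equiv> act M Q0"
abbreviation "q1 \<equiv> act M Q1"
abbreviation "q2 \<equiv> act M (Sq 2)"

lemma grading: "is_grading (component M)"
  using module by (simp add: graded_module_def)

lemma act_add_right: "r \<in> A1 \<Longrightarrow> act M r (x + y) = act M r x + act M r y"
  using module by (simp add: graded_module_def)

lemma act_add: "r \<in> A1 \<Longrightarrow> s \<in> A1 \<Longrightarrow> act M (r + s) x = act M r x + act M s x"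
  using module by (simp add: graded_module_def)

lemma act_mult: "r \<in> A1 \<Longrightarrow> s \<in> A1 \<Longrightarrow> act M (r * s) x = act M r (act M s x)"
  using module by (simp add: graded_module_def)

lemma act_one: "act M 1 x = x"
  using module by (simp add: graded_module_def)

lemma act_zero: "act M 0 x = 0"
  using act_add[OF A1_closed(5,5), of x] by simp

lemma act_homogeneous:
  "r \<in> A1 \<Longrightarrow> r \<in> steenrod_homogeneous k \<Longrightarrow> x \<in> component M n \<Longrightarrow> act M r x \<in> component M (k + n)"
  using module unfolding graded_module_def by blast

lemma char2: "x + x = (0::'m)"
  using act_add[OF A1_closed(6,6), of x] by (simp add: steenrod_char2 act_one act_zero)

lemma q_add: "q0 (x + y) = q0 x + q0 y" "q1 (x + y) = q1 x + q1 y" "q2 (x + y) = q2 x + q2 y"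
  by (simp_all add: act_add_right A1_closed)

lemma q0_q0: "q0 (q0 x) = 0"
proof -
  have "act M (Q0 * Q0) x = 0"
    using Sq_1_1 by (simp add: Q0_def act_zero)
  then show ?thesis by (simp add: act_mult A1_closed)
qed

lemma q2_q2: "q2 (q2 x) = q0 (q2 (q0 x))"
proof -
  have "act M (Sq 2 * Sq 2) x = act M (Q0 * Sq 2 * Q0) x"
    by (simp only: Sq_2_2 Q0_def)
  then show ?thesis by (simp add: act_mult A1_closed)
qed

lemma q1_eq: "q1 x = q0 (q2 x) + q2 (q0 x)"
proof -
  have "q1 x = act M (Q0 * Sq 2 + Sq 2 * Q0) x" by (simp only: Q1_def Q0_def)
  also have "\<dots> = q0 (q2 x) + q2 (q0 x)" by (simp add: act_add act_mult A1_closed)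
  finally show ?thesis .
qed

text \<open>
  These are the two ways of rewriting \<open>Sq\<^sup>2 Sq\<^sup>2 Sq\<^sup>2\<close> by \<open>q2_q2\<close>.  With this equation added, \<open>q0_q0\<close>
  and \<open>q2_q2\<close> become a set of rewrite rules that brings every word in \<open>Sq\<^sup>1\<close> and \<open>Sq\<^sup>2\<close> into a
  normal form.
\<close>

lemma q2_q0_q2_q0: "q2 (q0 (q2 (q0 x))) = q0 (q2 (q0 (q2 x)))"
  by (metis q2_q2)

lemma q_zero: "q0 0 = 0" "q1 0 = 0" "q2 0 = 0"
  using q_add[of 0 0] by simp_all

lemma ht_char2: "z + z = (0 :: 'm htensor)"
  by (rule htensor_char2) (rule char2)

lemma ht_char2': "z + (z + z') = (z' :: 'm htensor)"
  by (simp add: ht_char2 flip: add.assoc)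

lemmas tensor_add = tensor_add_left[OF char2] tensor_add_right

lemma tensor_zero: "0 \<otimes>\<^sub>H x = 0" "h \<otimes>\<^sub>H (0::'m) = 0"
  by (simp_all add: tensor_def linear_extension_def)

lemma R_op_add: "R_op M i (z + z') = R_op M i z + R_op M i z'"
  by (cases i) (simp_all add: R_op.simps tensor_lift_add tensor_add q_add ac_simps)

lemma R_op_zero: "R_op M i 0 = 0"
  using R_op_add[of i 0 0] by simp

lemma R_op_tensor:
  "R_op M EQ0 (h \<otimes>\<^sub>H x) = H_Q0 h \<otimes>\<^sub>H x + h \<otimes>\<^sub>H q0 x"
  "R_op M EQ1 (h \<otimes>\<^sub>H x) = H_Q1 h \<otimes>\<^sub>H x + (H_a \<cdot> H_Q0 h) \<otimes>\<^sub>H q0 x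
     + (H_a \<cdot> h) \<otimes>\<^sub>H q2 x + (H_sigma_inv \<cdot> h) \<otimes>\<^sub>H q1 x"
  unfolding R_op.simps
  by (rule tensor_lift_tensor; simp add: tensor_add q_add H_operator_add ac_simps)+

lemma htensor_induct [case_names add tensor]:
  assumes "\<And>z z'. P z \<Longrightarrow> P z' \<Longrightarrow> P (z + z')" "\<And>h x. P (h \<otimes>\<^sub>H x)"
  shows "P (z :: 'm htensor)"
  using assms(2)[of 0 0] assms(2)[of "hb _"] assms(1)
  by (induction z rule: poly_mapping_induct) (simp_all add: tensor_zero)

lemmas R_op_relation_simps =
  R_op_add R_op_tensor R_op_zero tensor_add tensor_zero H_operator_add
  H_Q0_Q0 H_Q1_Q1 H_Q1_Q0 H_sigma_inv_a H_Q0_a H_Q1_a H_Q0_sigma_inv H_Q1_sigma_inv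
  q1_eq q_add q0_q0 q2_q2 q2_q0_q2_q0 q_zero ht_char2 ht_char2'

text \<open>
  On \<open>h \<otimes> x\<close> the rewrite rules expand both sides into sums of tensors in normal form, where equal
  terms cancel in pairs.  The cancellations that are not mere symmetry are as follows.  In
  \<open>\<Q>\<^sub>1 \<Q>\<^sub>0 + \<Q>\<^sub>0 \<Q>\<^sub>1\<close>, the error term \<open>a h \<otimes> Q\<^sub>1 x\<close> of \<open>\<Q>\<^sub>0 (\<sigma>\<^sup>-\<^sup>1 h)\<close> meets
  \<open>a h \<otimes> (Q\<^sub>0 Sq\<^sup>2 + Sq\<^sup>2 Q\<^sub>0) x\<close>.  In \<open>\<Q>\<^sub>1 \<Q>\<^sub>1\<close>, the error term \<open>a\<^sup>2 \<Q>\<^sub>0 h \<otimes> Q\<^sub>1 x\<close> of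
  \<open>\<Q>\<^sub>1 (\<sigma>\<^sup>-\<^sup>1 h)\<close> meets \<open>a\<^sup>2 \<Q>\<^sub>0 h \<otimes> (Q\<^sub>0 Sq\<^sup>2 + Sq\<^sup>2 Q\<^sub>0) x\<close>, and \<open>a\<^sup>2 h \<otimes> Q\<^sub>0 Q\<^sub>1 x\<close> meets
  \<open>a\<^sup>2 h \<otimes> Sq\<^sup>2 Sq\<^sup>2 x\<close>; the remaining terms vanish because \<open>Q\<^sub>1\<close> commutes with \<open>Sq\<^sup>2\<close> and has
  square zero.
\<close>

lemma R_op_relations:
  "R_op M EQ0 (R_op M EQ0 z) = 0"
  "R_op M EQ1 (R_op M EQ1 z) = 0"
  "R_op M EQ1 (R_op M EQ0 z) = R_op M EQ0 (R_op M EQ1 z)"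
  by (induction z rule: htensor_induct; simp add: R_op_relation_simps ac_simps)+

sublocale exterior_operators "R_op M"
proof
  show "R_op M i (R_op M i z) = 0" for i z
    by (cases i) (simp_all add: R_op_relations)
  show "R_op M i (R_op M j z) = R_op M j (R_op M i z)" for i j z
    by (cases i; cases j) (simp_all add: R_op_relations)
qed (simp_all add: ht_char2 R_op_add)

lemma act_R_abs: "act (R M) (abs_exterior p) z = free_act (R_op M) p z"
  by (simp add: R_def free_act_rep_abs)

lemma component_R_add:
  "z \<in> component (R M) d \<Longrightarrow> z' \<in> component (R M) d \<Longrightarrow> z + z' \<in> component (R M) d"
  by (simp add: component_R direct_sum_grading_add[OF grading inj_htensor_degree])

lemma component_R_induct [consumes 1, case_names zero add single]:
  assumes "z \<in> component (R M) d"
    and "P 0" and "\<And>z z'. P z \<Longrightarrow> P z' \<Longrightarrow> P (z + z')"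
    and "\<And>b x n. x \<in> component M n \<Longrightarrow> hdegree b + (n, 0) = d \<Longrightarrow> P (hb b \<otimes>\<^sub>H x)"
  shows "P z"
proof -
  have "P (Poly_Mapping.single b (Poly_Mapping.lookup z b))" if "b \<in> Poly_Mapping.keys z" for b
    using assms(1,4) that by (auto simp: R_def)
  then have "P (\<Sum>b\<in>K. Poly_Mapping.single b (Poly_Mapping.lookup z b))"
    if "K \<subseteq> Poly_Mapping.keys z" for K
    using that by (induction K rule: infinite_finite_induct) (simp_all add: assms(2,3))
  from this[OF order_refl] show ?thesis by (simp only: sum_singles)
qed

lemma R_op_homogeneous:
  assumes "z \<in> component (R M) d"
  shows "R_op M i z \<in> component (R M) (egen_degree i + d)"
  using assms
proof (induction rule: component_R_induct)
  case zero
  then show ?case by (simp add: R_op_zero component_R direct_sum_grading_zero)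
next
  case (add z z')
  then show ?case by (simp add: R_op_add component_R_add)
next
  case (single b x n)
  note q = act_homogeneous[OF A1_closed(3) Q0_homogeneous single(1)]
    act_homogeneous[OF A1_closed(2) Sq_homogeneous single(1)]
    act_homogeneous[OF A1_closed(4) Q1_homogeneous single(1)]
  have b: "hb b \<in> H_homogeneous (hdegree b)" by (simp add: H_homogeneous_def)
  note h = H_operator_homogeneous[OF b]
  have d: "d = hdegree b + (n, 0)" using single(2) by simp
  note t = tensor_homogeneous[OF grading, folded component_R]
  show ?case
  proof (cases i)
    case EQ0
    have "H_Q0 (hb b) \<otimes>\<^sub>H x \<in> component (R M) ((1, 0) + d)"
      by (rule t[OF h(1) single(1)]) (simp add: d add.assoc)
    moreover have "hb b \<otimes>\<^sub>H q0 x \<in> component (R M) ((1, 0) + d)"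
      by (rule t[OF b q(1)]) (simp add: d prod_eq_iff)
    ultimately show ?thesis
      by (simp only: EQ0 R_op_tensor egen_degree.simps component_R_add)
  next
    case EQ1
    have "H_Q1 (hb b) \<otimes>\<^sub>H x \<in> component (R M) ((2, 1) + d)"
      by (rule t[OF h(2) single(1)]) (simp add: d add.assoc)
    moreover have "(H_a \<cdot> H_Q0 (hb b)) \<otimes>\<^sub>H q0 x \<in> component (R M) ((2, 1) + d)"
      by (rule t[OF H_operator_homogeneous(3)[OF h(1)] q(1)]) (simp add: d prod_eq_iff)
    moreover have "(H_a \<cdot> hb b) \<otimes>\<^sub>H q2 x \<in> component (R M) ((2, 1) + d)"
      by (rule t[OF h(3) q(2)]) (simp add: d prod_eq_iff)
    moreover have "(H_sigma_inv \<cdot> hb b) \<otimes>\<^sub>H q1 x \<in> component (R M) ((2, 1) + d)"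
      by (rule t[OF h(4) q(3)]) (simp add: d prod_eq_iff)
    ultimately show ?thesis
      by (simp only: EQ1 R_op_tensor egen_degree.simps component_R_add)
  qed
qed

lemma free_act_homogeneous:
  assumes "p \<in> free_homogeneous egen_degree k" "z \<in> component (R M) d"
  shows "free_act (R_op M) p z \<in> component (R M) (k + d)"
proof -
  have word: "foldr (R_op M) gs z \<in> component (R M) (sum_list (map egen_degree gs) + d)" for gs
    using assms(2) by (induction gs) (simp_all add: R_op_homogeneous add.assoc flip: zero_prod_def)
  have "(\<Sum>w\<in>W. foldr (R_op M) (letters w) z) \<in> component (R M) (k + d)"
    if "W \<subseteq> Poly_Mapping.keys p" for W
    using that
  proof (induction W rule: infinite_finite_induct)
    case (insert w W)
    then have "sum_list (map egen_degree (letters w)) = k"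
      using assms(1) by (simp add: free_homogeneous_def word_degree_def)
    with insert word[of "letters w"] show ?case by (simp add: component_R_add)
  qed (simp_all add: component_R direct_sum_grading_zero)
  then show ?thesis by (simp add: free_act_def)
qed

theorem graded_module_R: "graded_module UNIV E_homogeneous (R M)"
  unfolding graded_module_def
proof (intro conjI ballI allI)
  show "is_grading (component (R M))"
    unfolding component_R by (rule is_grading_direct_sum[OF grading inj_htensor_degree])
  fix r s :: E and z z' :: "'m htensor" and k d
  obtain p where p: "r = abs_exterior p" using Quotient3_abs_rep[OF Quotient3_exterior] by metis
  obtain p' where p': "s = abs_exterior p'" using Quotient3_abs_rep[OF Quotient3_exterior] by metis
  show "act (R M) r (z + z') = act (R M) r z + act (R M) r z'"
    by (simp add: p act_R_abs free_act_add_right)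
  show "act (R M) (r + s) z = act (R M) r z + act (R M) s z"
    by (simp add: p p' plus_exterior.abs_eq act_R_abs free_act_add[OF ht_char2])
  show "act (R M) (r * s) z = act (R M) r (act (R M) s z)"
    by (simp add: p p' times_exterior.abs_eq act_R_abs free_act_mult)
  show "act (R M) 1 z = z"
    by (simp add: one_exterior.abs_eq act_R_abs free_act_def zero_word_def)
  show "act (R M) r z \<in> component (R M) (k + d)"
    if "r \<in> UNIV \<inter> E_homogeneous k" "z \<in> component (R M) d"
    using that by (auto simp: E_homogeneous_def act_R_abs intro: free_act_homogeneous)
qed

lemma act_R_gen: "act (R M) (exterior_gen i) z = R_op M i z"
  by (simp add: exterior_gen.abs_eq act_R_abs letter_def)

end


section \<open>Functoriality and exactness of R\<close>

lemma lookup_R_map: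
  assumes "f 0 = 0"
  shows "Poly_Mapping.lookup (R_map f z) b = f (Poly_Mapping.lookup z b)"
proof -
  have "Poly_Mapping.lookup (R_map f z) b
      = (\<Sum>k\<in>Poly_Mapping.keys z. if k = b then f (Poly_Mapping.lookup z b) else 0)"
    unfolding R_map_def tensor_lift_def tensor_hb lookup_sum
    by (intro sum.cong) (auto simp: lookup_single when_def)
  then show ?thesis by (simp add: assms in_keys_iff)
qed

lemma inj_R_map:
  fixes f :: "'m::ab_group_add \<Rightarrow> 'n::ab_group_add"
  assumes "f 0 = 0" "inj f"
  shows "inj (R_map f)"
proof (rule injI)
  fix z z' :: "'m htensor"
  assume "R_map f z = R_map f z'"
  then have "f (Poly_Mapping.lookup z b) = f (Poly_Mapping.lookup z' b)" for b
    using lookup_R_map[of f, OF assms(1)] by metis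
  then show "z = z'"
    using assms(2) by (intro poly_mapping_eqI) (auto dest: injD)
qed

text \<open>
  Preimages are chosen coordinatewise, but only on the support, so that the family stays finitely
  supported.
\<close>

lemma range_R_map:
  fixes f :: "'m::ab_group_add \<Rightarrow> 'n::ab_group_add"
  assumes "f 0 = 0"
  shows "range (R_map f) = {z. \<forall>b. Poly_Mapping.lookup z b \<in> range f}"
proof (intro equalityI subsetI)
  fix z :: "'n htensor"
  assume "z \<in> {z. \<forall>b. Poly_Mapping.lookup z b \<in> range f}"
  then have z: "f (inv f (Poly_Mapping.lookup z b)) = Poly_Mapping.lookup z b" for b
    by (simp add: f_inv_into_f)
  let ?w = "\<Sum>b\<in>Poly_Mapping.keys z. Poly_Mapping.single b (inv f (Poly_Mapping.lookup z b))"
  have "R_map f ?w = z"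
    by (rule poly_mapping_eqI)
      (auto simp: lookup_R_map[of f, OF assms] lookup_sum lookup_single when_def in_keys_iff assms z)
  then show "z \<in> range (R_map f)" by (rule range_eqI[OF sym])
qed (auto simp: lookup_R_map[of f, OF assms])

lemma R_map_homogeneous:
  assumes "f 0 = 0" "\<And>n. f ` component M n \<subseteq> component N n"
  shows "R_map f ` component (R M) d \<subseteq> component (R N) d"
  using assms by (fastforce simp: R_def lookup_R_map in_keys_iff)

text \<open>
  Additivity alone is assumed, since the maps \<open>f\<close> and \<open>g\<close> are linear over \<open>A(1)\<close>, but the section is
  linear only over \<open>\<Lambda>(Q\<^sub>0)\<close>.
\<close>

locale a1_additive_map = M: a1_module M + N: a1_module N
  for M :: "(steenrod, int, 'm::ab_group_add) gmodule"
    and N :: "(steenrod, int, 'n::ab_group_add) gmodule" +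
  fixes f :: "'m \<Rightarrow> 'n"
  assumes f_add: "f (x + y) = f x + f y"
begin

lemma f_zero: "f 0 = 0"
  using f_add[of 0 0] by simp

lemma R_map_add: "R_map f (z + z') = R_map f z + R_map f z'"
  by (rule poly_mapping_eqI) (simp add: lookup_R_map f_zero lookup_add f_add)

lemma R_map_tensor: "R_map f (h \<otimes>\<^sub>H x) = h \<otimes>\<^sub>H f x"
  unfolding R_map_def
  by (rule tensor_lift_tensor) (simp_all add: M.tensor_add N.tensor_add f_add)

lemma R_map_R_op_EQ0:
  assumes "\<And>x. f (act M Q0 x) = act N Q0 (f x)"
  shows "R_map f (R_op M EQ0 z) = R_op N EQ0 (R_map f z)"
  by (induction z rule: M.htensor_induct)
    (simp_all add: R_map_add R_map_tensor M.R_op_add N.R_op_add M.R_op_tensor N.R_op_tensor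
      assms)

lemma R_map_R_op_EQ1:
  assumes "\<And>x. f (act M Q0 x) = act N Q0 (f x)" "\<And>x. f (act M (Sq 2) x) = act N (Sq 2) (f x)"
    "\<And>x. f (act M Q1 x) = act N Q1 (f x)"
  shows "R_map f (R_op M EQ1 z) = R_op N EQ1 (R_map f z)"
  by (induction z rule: M.htensor_induct)
    (simp_all add: R_map_add R_map_tensor M.R_op_add N.R_op_add M.R_op_tensor N.R_op_tensor
      assms)

lemma R_map_free_act:
  assumes "\<And>i z. R_map f (R_op M i z) = R_op N i (R_map f z)"
  shows "R_map f (free_act (R_op M) p z) = free_act (R_op N) p (R_map f z)"
proof -
  have "R_map f (foldr (R_op M) gs z) = foldr (R_op N) gs (R_map f z)" for gs
    by (induction gs) (simp_all add: assms)
  then show ?thesis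
    by (simp add: free_act_def additive_sum[of "R_map f", OF R_map_add])
qed

lemma graded_hom_R_map:
  assumes "graded_hom A1 M N f"
  shows "graded_hom UNIV (R M) (R N) (R_map f)"
proof -
  have f: "r \<in> A1 \<Longrightarrow> f (act M r x) = act N r (f x)" "f ` component M n \<subseteq> component N n" for r x n
    using assms by (simp_all add: graded_hom_def)
  have op: "R_map f (R_op M i z) = R_op N i (R_map f z)" for i z
    by (cases i) (simp_all only: R_map_R_op_EQ0 R_map_R_op_EQ1 f A1_closed)
  show ?thesis
    unfolding graded_hom_def
    using R_map_homogeneous[OF f_zero f(2)] R_map_add
    by (simp add: R_def R_map_free_act[OF op])
qed

text \<open>
  \<open>\<Lambda>\<^sub>0\<close> is generated by \<open>\<Q>\<^sub>0\<close>, whose action on \<open>H \<otimes> M\<close> involves no operation on \<open>M\<close> other than \<open>Q\<^sub>0\<close>.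
\<close>

lemma graded_hom_R_map_Lambda0:
  assumes "graded_hom LambdaQ0 M N f"
  shows "graded_hom Lambda0 (R M) (R N) (R_map f)"
proof -
  have "Q0 \<in> LambdaQ0"
    by (simp add: LambdaQ0_def generated_subalgebra.gen)
  then have f: "f (act M Q0 x) = act N Q0 (f x)" "f ` component M n \<subseteq> component N n" for x n
    using assms by (simp_all add: graded_hom_def)
  have act_diff: "act (R P) (r - s) z = act (R P) r z - act (R P) s z"
    if "graded_module UNIV E_homogeneous (R P)"
    for P :: "(steenrod, int, 'p::ab_group_add) gmodule" and r s :: E and z
  proof -
    have "act (R P) (r - s + s) z = act (R P) (r - s) z + act (R P) s z"
      using that unfolding graded_module_def by blast
    then show ?thesis by simp
  qed
  have act_mult: "act (R P) (r * s) z = act (R P) r (act (R P) s z)"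
    "act (R P) 1 z = z"
    if "graded_module UNIV E_homogeneous (R P)"
    for P :: "(steenrod, int, 'p::ab_group_add) gmodule" and r s :: E and z
    using that unfolding graded_module_def by blast+
  have R_map_diff: "R_map f (z - z') = R_map f z - R_map f z'" for z z'
    using R_map_add[of "z - z'" z'] by simp
  have "R_map f (act (R M) r z) = act (R N) r (R_map f z)" if "r \<in> Lambda0" for r z
    using that unfolding Lambda0_def
  proof (induction arbitrary: z)
    case (gen r)
    then show ?case by (simp only: singleton_iff M.act_R_gen N.act_R_gen R_map_R_op_EQ0 f)
  qed (simp_all add: act_diff act_mult M.graded_module_R N.graded_module_R R_map_diff)
  then show ?thesis
    unfolding graded_hom_def
    using R_map_homogeneous[OF f_zero f(2)] R_map_add by simp
qed

end

theorem theorem4p18: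
  fixes A :: "(steenrod, int, 'a::ab_group_add) gmodule"
    and B :: "(steenrod, int, 'b::ab_group_add) gmodule"
    and C :: "(steenrod, int, 'c::ab_group_add) gmodule"
    and f :: "'a \<Rightarrow> 'b" and g :: "'b \<Rightarrow> 'c"
  assumes "short_exact_sequence A1 steenrod_homogeneous A B C f g"
    and "splits LambdaQ0 B C g"
  shows "short_relative_exact_sequence UNIV Lambda0 E_homogeneous
           (R A) (R B) (R C) (R_map f) (R_map g)"
proof -
  have exact: "inj f" "range f = {y. g y = 0}" "surj g"
    and hom: "graded_hom A1 A B f" "graded_hom A1 B C g"
    and modules: "a1_module A" "a1_module B" "a1_module C"
    using assms(1) by (simp_all add: short_exact_sequence_def a1_module_def)
  obtain s where s: "graded_hom LambdaQ0 C B s" "\<And>z. g (s z) = z"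
    using assms(2) by (auto simp: splits_def)
  interpret f: a1_additive_map A B f
    using modules hom(1)
    by (simp add: a1_additive_map_def a1_additive_map_axioms_def graded_hom_def)
  interpret g: a1_additive_map B C g
    using modules hom(2)
    by (simp add: a1_additive_map_def a1_additive_map_axioms_def graded_hom_def)
  interpret s: a1_additive_map C B s
    using modules s(1)
    by (simp add: a1_additive_map_def a1_additive_map_axioms_def graded_hom_def)
  have kernel: "R_map g z = 0 \<longleftrightarrow> (\<forall>b. g (Poly_Mapping.lookup z b) = 0)" for z
    by (simp add: poly_mapping_eq_iff fun_eq_iff lookup_R_map g.f_zero)
  have "short_exact_sequence UNIV E_homogeneous (R A) (R B) (R C) (R_map f) (R_map g)"
    unfolding short_exact_sequence_def
  proof (intro conjI)
    show "range (R_map f) = {z. R_map g z = 0}"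
      by (simp add: range_R_map f.f_zero kernel exact(2))
    show "surj (R_map g)"
      by (simp add: range_R_map g.f_zero exact(3))
  qed (fact f.M.graded_module_R f.N.graded_module_R g.N.graded_module_R
      f.graded_hom_R_map[OF hom(1)] g.graded_hom_R_map[OF hom(2)]
      inj_R_map[OF f.f_zero exact(1)])+
  moreover have "splits Lambda0 (R B) (R C) (R_map g)"
    unfolding splits_def
  proof (intro exI conjI allI)
    show "graded_hom Lambda0 (R C) (R B) (R_map s)"
      by (rule s.graded_hom_R_map_Lambda0[OF s(1)])
    show "R_map g (R_map s z) = z" for z
      by (rule poly_mapping_eqI) (simp add: lookup_R_map g.f_zero s.f_zero s(2))
  qed
  ultimately show ?thesis
    by (simp add: short_relative_exact_sequence_def)
qed

end
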